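(* Let $\Sigma$ be a closed, oriented surface of genus $g\geqslant 1$, let $w\to\Sigma\times S^1$ be a Hermitian line bundle whose first Chern class is Poincaré dual to the circle factor $\{\mathrm{pt}\}\times S^1$, and let $u$ be the degree-four endomorphism of the instanton Floer homology $I(\Sigma\times S^1)_w$. Then \[ \min\Big\{n\geqslant 1:\ (u^2-64)^n=0 \text{ on } I(\Sigma\times S^1)_w\Big\}\;=\;2\lceil g/2\rceil-1 . \]
   Context: $I(\Sigma\times S^1)_w$ denotes Floer's relatively $\mathbb{Z}/8$-graded instanton homology (complex coefficients) for the $SO(3)$-bundle determined by $w$; $u$ is its standard degree-four endomorphism (the $u$-map). The following known facts describe the module $(I(\Sigma\times S^1)_w,u)$ completely: $I(\Sigma\times S^1)_w$ carries a degree-four involution commuting with $u$, the quotient is denoted $I(\Sigma\times S^1)'_w$, and as $\mathbb{C}[u]$-modules $I(\Sigma\times S^1)_w\cong I(\Sigma\times S^1)'_w\oplus I(\Sigma\times S^1)'_w$. By Muñoz's theorem, $I(\Sigma\times S^1)'_w$ is isomorphic as a ring to \[\bigoplus_{k=0}^{g}\Lambda^k_0H\otimes \mathbb{C}[\alpha,\beta,\gamma]/J_{g-k},\] with $u$ acting as multiplication by $\beta$. Here $H=H^1(\Sigma;\mathbb{C})$ with symplectic basis $\{\gamma_i,\gamma_{i+g}\}_{i=1}^g$, $\gamma_i\cdot\gamma_{i+g}=1$; $\Lambda^k_0H=\ker\big(\,\cdot\wedge\gamma^{g-k+1}:\Lambda^kH\to\Lambda^{2g-k+2}H\big)$ where $\gamma=-2\sum_{i=1}^g\gamma_i\wedge\gamma_{i+g}$.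 The polynomials $\zeta_k\in\mathbb{C}[\alpha,\beta,\gamma]$ are defined by $\zeta_i=0$ for $i<0$, $\zeta_0=1$, and $\zeta_{k+1}=\alpha\zeta_k+k^2(\beta+(-1)^k8)\zeta_{k-1}+2k(k-1)\gamma\zeta_{k-2}$ for $k\geqslant 0$, and $J_k=(\zeta_k,\zeta_{k+1},\zeta_{k+2})$. *)

theory Defs
  imports "HOL-Computational_Algebra.Polynomial"
begin

text \<open>Algebraic model of Floer's instanton homology I(Sigma x S^1)_w as a C[u]-module,
  following the description in the context (Munoz's theorem).
  The ring C[alpha,beta,gamma] is modelled as nested univariate polynomials
  complex poly poly poly: innermost variable alpha, middle beta, outermost gamma.\<close>

type_synonym R = "complex poly poly poly"

definition alpha :: R where "alpha = [:[:[:0, 1:]:]:]"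
definition beta :: R where "beta = [:[:0, 1:]:]"
definition gamma :: R where "gamma = [:0, 1:]"

text \<open>zeta k, with the convention zeta i = 0 for i < 0, zeta 0 = 1 and
  zeta (k+1) = alpha zeta k + k^2 (beta + (-1)^k 8) zeta (k-1) + 2k(k-1) gamma zeta (k-2).\<close>
fun zeta :: "nat \<Rightarrow> R" where
  "zeta 0 = 1"
| "zeta (Suc k) =
     alpha * zeta k
     + of_nat (k^2) * (beta + (-1)^k * 8) * (case k of 0 \<Rightarrow> 0 | Suc j \<Rightarrow> zeta j)
     + of_nat (2 * k * (k - 1)) * gamma * (case k of Suc (Suc i) \<Rightarrow> zeta i | _ \<Rightarrow> 0)"

definition in_J :: "nat \<Rightarrow> R \<Rightarrow> bool" where
  "in_J k p \<longleftrightarrow> (\<exists>a b c. p = a * zeta k + b * zeta (k + 1) + c * zeta (k + 2))"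

text \<open>Exterior algebra of H = H^1(Sigma;C) with basis indexed by 0..2g-1
  (index i-1 for gamma_i; the symplectic pairs are (i, i+g) for i < g).
  An element is a coefficient function on finite subsets (basis e_A = wedge of e_a,
  a in A, in increasing order).\<close>
definition wsign :: "nat set \<Rightarrow> nat set \<Rightarrow> 'a::comm_ring_1" where
  "wsign A B = (-1) ^ card {(a, b). a \<in> A \<and> b \<in> B \<and> b < a}"

definition wedge :: "(nat set \<Rightarrow> 'a::comm_ring_1) \<Rightarrow> (nat set \<Rightarrow> 'a) \<Rightarrow> nat set \<Rightarrow> 'a" where
  "wedge x y C = (\<Sum>A\<in>Pow C. wsign A (C - A) * x A * y (C - A))"

definition wunit :: "nat set \<Rightarrow> 'a::comm_ring_1" where
  "wunit C = (if C = {} then 1 else 0)"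

text \<open>The 2-form gamma = -2 * sum_{i} gamma_i wedge gamma_{i+g}, and its powers.\<close>
definition gammaH :: "nat \<Rightarrow> nat set \<Rightarrow> 'a::comm_ring_1" where
  "gammaH g C = (if \<exists>i<g. C = {i, i + g} then -2 else 0)"

definition gammaH_pow :: "nat \<Rightarrow> nat \<Rightarrow> nat set \<Rightarrow> 'a::comm_ring_1" where
  "gammaH_pow g m = ((\<lambda>x. wedge x (gammaH g)) ^^ m) wunit"

text \<open>Elements of Lambda^k_0 H \<otimes> C[alpha,beta,gamma]/J_{g-k}: coefficient functions
  supported on k-subsets of {0..<2g}, with values in R taken modulo J_{g-k},
  lying in the kernel of (wedge with gamma^{g-k+1}) \<otimes> id.\<close>
definition prim_elem :: "nat \<Rightarrow> nat \<Rightarrow> (nat set \<Rightarrow> R) \<Rightarrow> bool" where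
  "prim_elem g k c \<longleftrightarrow>
     (\<forall>A. c A \<noteq> 0 \<longrightarrow> A \<subseteq> {..<2 * g} \<and> card A = k) \<and>
     (\<forall>C. in_J (g - k) (wedge c (gammaH_pow g (g - k + 1)) C))"

definition Iprime :: "nat \<Rightarrow> (nat \<Rightarrow> nat set \<Rightarrow> R) set" where
  "Iprime g = {x. (\<forall>k. g < k \<longrightarrow> x k = (\<lambda>_. 0)) \<and> (\<forall>k\<le>g. prim_elem g k (x k))}"

definition Iprime_zero :: "nat \<Rightarrow> (nat \<Rightarrow> nat set \<Rightarrow> R) \<Rightarrow> bool" where
  "Iprime_zero g x \<longleftrightarrow> (\<forall>k\<le>g. \<forall>A. in_J (g - k) (x k A))"

definition u_map :: "(nat \<Rightarrow> nat set \<Rightarrow> R) \<Rightarrow> (nat \<Rightarrow> nat set \<Rightarrow> R)" where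
  "u_map x = (\<lambda>k A. beta * x k A)"

definition u2_minus_64 :: "(nat \<Rightarrow> nat set \<Rightarrow> R) \<Rightarrow> (nat \<Rightarrow> nat set \<Rightarrow> R)" where
  "u2_minus_64 x = (\<lambda>k A. u_map (u_map x) k A - 64 * x k A)"

text \<open>I(Sigma x S^1)_w = I'_w \<oplus> I'_w as C[u]-modules, u acting diagonally.
  (u^2 - 64)^n = 0 on I(Sigma x S^1)_w.\<close>
definition op_vanishes_on_I :: "nat \<Rightarrow> nat \<Rightarrow> bool" where
  "op_vanishes_on_I g n \<longleftrightarrow>
     (\<forall>(x, y) \<in> Iprime g \<times> Iprime g.
        Iprime_zero g ((u2_minus_64 ^^ n) x) \<and> Iprime_zero g ((u2_minus_64 ^^ n) y))"

end

theory Submission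
  imports Defs
    "HOL-Computational_Algebra.Fundamental_Theorem_Algebra"
    "HOL-Computational_Algebra.Field_as_Ring"
    "HOL-Computational_Algebra.Polynomial_Factorial"
begin

text \<open>Since \<open>J\<^sub>g\<close> decreases with \<open>g\<close> and \<open>\<Lambda>\<^sup>0\<^sub>0 H\<close> contains the unit, \<open>(u\<^sup>2 - 64)\<^sup>n\<close> vanishes iff
  \<open>D\<^sup>n \<in> J\<^sub>g\<close>, where \<open>D = \<beta>\<^sup>2 - 64\<close>.

  Upper bound. At a common zero of \<open>J\<^sub>g\<close>, with \<open>\<zeta>\<^sub>j\<close> the last non-vanishing \<open>\<zeta>\<close>, the elements
  \<open>\<zeta>\<^bsub>j+2m-1\<^esub>\<close> and \<open>\<zeta>\<^bsub>j+2m\<^esub>\<close> lie in \<open>J\<^sub>g + (D, \<gamma>)\<^sup>m\<close> locally, and \<open>\<zeta>\<^bsub>j+2m\<^esub>\<close> is a unit times \<open>D \<zeta>\<^bsub>j+2m-2\<^esub>\<close> up to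
  \<open>\<gamma> (D, \<gamma>)\<^bsup>m-1\<^esup>\<close> and higher order. This gives \<open>D\<^bsup>g-1\<^esup> \<in> J\<^sub>g + \<gamma> (D, \<gamma>)\<^bsup>g-2\<^esup>\<close>, first locally and then globally.
  As \<open>\<gamma> J\<^sub>g \<subseteq> J\<^bsub>g+1\<^esub>\<close>, induction yields \<open>D\<^bsup>g-1\<^esup> \<equiv> c \<gamma>\<^bsup>g-1\<^esup>\<close> modulo \<open>J\<^sub>g\<close> with a constant \<open>c\<close>; for even \<open>g\<close> the
  symmetry \<open>(\<alpha>, \<gamma>) \<mapsto> (-\<alpha>, -\<gamma>)\<close> then forces \<open>D\<^bsup>g-1\<^esup> \<in> J\<^sub>g\<close>.

  Lower bound for \<open>g = 2h + 1\<close>. Substitute \<open>\<gamma> = t\<close>, \<open>\<beta> = 8 + t x\<close> and for \<open>\<alpha>\<close> an approximate root of \<open>\<zeta>\<^sub>g\<close>.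
  Then \<open>\<zeta>\<^bsub>2m\<^esub>\<close> has order \<open>m\<close> in \<open>t\<close>, and the leading coefficients are orthogonal polynomials \<open>q\<^sub>m(x)\<close>
  for a positive definite moment functional. From \<open>D\<^bsup>2h\<^esup> \<in> J\<^sub>g\<close> one would get
  \<open>x\<^bsup>2h\<^esup> = P q\<^bsub>h+1\<^esub> + Q q\<^sub>h\<close> with \<open>deg P, deg Q < h\<close>; the functional kills the right-hand side but not \<open>x\<^bsup>2h\<^esup>\<close>.\<close>

subsection \<open>Ideals, localization and filtrations\<close>

definition ring_ideal :: "'a::comm_ring_1 set \<Rightarrow> bool" where
  "ring_ideal I \<longleftrightarrow> 0 \<in> I \<and> (\<forall>x\<in>I. \<forall>y\<in>I. x + y \<in> I) \<and> (\<forall>r. \<forall>x\<in>I. r * x \<in> I)"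

lemma ring_idealD:
  assumes "ring_ideal I"
  shows ring_ideal_zero: "0 \<in> I"
    and ring_ideal_add: "x \<in> I \<Longrightarrow> y \<in> I \<Longrightarrow> x + y \<in> I"
    and ring_ideal_mult: "x \<in> I \<Longrightarrow> r * x \<in> I"
  using assms by (auto simp: ring_ideal_def)

lemma ring_ideal_minus:
  fixes x :: "'a::comm_ring_1"
  assumes "ring_ideal I" "x \<in> I"
  shows "- x \<in> I"
  using ring_ideal_mult[OF assms, of "-1"] by simp

lemma ring_ideal_diff:
  fixes x y :: "'a::comm_ring_1"
  assumes "ring_ideal I" "x \<in> I" "y \<in> I"
  shows "x - y \<in> I"
  using ring_ideal_add[OF assms(1,2) ring_ideal_minus[OF assms(1,3)]] by simp

lemma ring_ideal_power_diff:
  fixes x y :: "'a::comm_ring_1"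
  assumes "ring_ideal I" "x - y \<in> I"
  shows "x ^ n - y ^ n \<in> I"
proof (induction n)
  case (Suc n)
  have "x ^ Suc n - y ^ Suc n = x * (x ^ n - y ^ n) + y ^ n * (x - y)"
    by (simp add: algebra_simps)
  then show ?case
    using ring_ideal_add[OF assms(1) ring_ideal_mult[OF assms(1) Suc] ring_ideal_mult[OF assms]] by simp
qed (simp add: ring_ideal_zero[OF assms(1)])

definition ideal_sum :: "'a::comm_ring_1 set \<Rightarrow> 'a set \<Rightarrow> 'a set" where
  "ideal_sum I K = {x + y | x y. x \<in> I \<and> y \<in> K}"

lemma ideal_sumI: "x \<in> I \<Longrightarrow> y \<in> K \<Longrightarrow> x + y \<in> ideal_sum I K"
  by (auto simp: ideal_sum_def)

lemma ring_ideal_sum: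
  assumes "ring_ideal I" "ring_ideal K"
  shows "ring_ideal (ideal_sum I K)"
  unfolding ring_ideal_def
proof (intro conjI ballI allI)
  show "0 \<in> ideal_sum I K"
    using ideal_sumI[OF ring_ideal_zero[OF assms(1)] ring_ideal_zero[OF assms(2)]] by simp
next
  fix x y assume "x \<in> ideal_sum I K" "y \<in> ideal_sum I K"
  then obtain a b c d where "x = a + b" "y = c + d" "a \<in> I" "c \<in> I" "b \<in> K" "d \<in> K"
    by (auto simp: ideal_sum_def)
  then show "x + y \<in> ideal_sum I K"
    using ideal_sumI[of "a + c" I "b + d" K] assms by (simp add: ring_ideal_add algebra_simps)
next
  fix r x assume "x \<in> ideal_sum I K"
  then obtain a b where "x = a + b" "a \<in> I" "b \<in> K"
    by (auto simp: ideal_sum_def)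
  then show "r * x \<in> ideal_sum I K"
    using ideal_sumI[of "r * a" I "r * b" K] assms by (simp add: ring_ideal_mult distrib_left)
qed

lemma ideal_sum_left: "ring_ideal K \<Longrightarrow> x \<in> I \<Longrightarrow> x \<in> ideal_sum I K"
  using ideal_sumI[of x I 0 K] by (simp add: ring_ideal_zero)

lemma ideal_sum_right: "ring_ideal I \<Longrightarrow> x \<in> K \<Longrightarrow> x \<in> ideal_sum I K"
  using ideal_sumI[of 0 I x K] by (simp add: ring_ideal_zero)

lemma ring_ideal_mult_image:
  assumes "ring_ideal I"
  shows "ring_ideal ((*) d ` I)"
  unfolding ring_ideal_def
proof (intro conjI ballI allI; (elim imageE)?)
  show "0 \<in> (*) d ` I"
    using ring_ideal_zero[OF assms] by force
next
  fix x y a b assume "x = d * a" "y = d * b" "a \<in> I" "b \<in> I"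
  then show "x + y \<in> (*) d ` I"
    using ring_ideal_add[OF assms] by (intro image_eqI[of _ _ "a + b"]) (auto simp: distrib_left)
next
  fix r x a assume "x = d * a" "a \<in> I"
  then show "r * x \<in> (*) d ` I"
    using ring_ideal_mult[OF assms] by (intro image_eqI[of _ _ "r * a"]) (auto simp: mult.left_commute)
qed

text \<open>The preimage in the ring of the extension of \<open>I\<close> to the localization at \<open>U\<close>.\<close>

definition localize :: "'a::comm_ring_1 set \<Rightarrow> 'a set \<Rightarrow> 'a set" where
  "localize U I = {x. \<exists>r\<in>U. r * x \<in> I}"

definition mult_set :: "'a::comm_ring_1 set \<Rightarrow> bool" where
  "mult_set U \<longleftrightarrow> 1 \<in> U \<and> (\<forall>r\<in>U. \<forall>t\<in>U. r * t \<in> U)"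

lemma ring_ideal_localize:
  assumes "mult_set U" "ring_ideal I"
  shows "ring_ideal (localize U I)"
  unfolding ring_ideal_def
proof (intro conjI ballI allI)
  show "0 \<in> localize U I"
    using assms by (auto simp: localize_def mult_set_def ring_ideal_def)
next
  fix x y assume "x \<in> localize U I" "y \<in> localize U I"
  then obtain r t where rt: "r \<in> U" "t \<in> U" "r * x \<in> I" "t * y \<in> I"
    by (auto simp: localize_def)
  have "(r * t) * (x + y) = t * (r * x) + r * (t * y)"
    by (simp add: algebra_simps)
  then have "(r * t) * (x + y) \<in> I"
    using rt assms(2) by (simp add: ring_ideal_add ring_ideal_mult)
  then show "x + y \<in> localize U I"
    using rt assms(1) unfolding localize_def mult_set_def by blast
next
  fix s x assume "x \<in> localize U I"
  then obtain r where "r \<in> U" "r * x \<in> I"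
    by (auto simp: localize_def)
  then have "r * (s * x) \<in> I"
    using ring_ideal_mult[OF assms(2), of "r * x" s] by (simp add: algebra_simps)
  then show "s * x \<in> localize U I"
    using \<open>r \<in> U\<close> by (auto simp: localize_def)
qed

lemma localize_incl:
  assumes "mult_set U" "x \<in> I"
  shows "x \<in> localize U I"
  using assms by (auto simp: localize_def mult_set_def intro!: bexI[of _ 1])

lemma localize_cancel:
  assumes "mult_set U" "u \<in> U" "u * x \<in> localize U I"
  shows "x \<in> localize U I"
proof -
  obtain r where "r \<in> U" "r * (u * x) \<in> I"
    using assms(3) by (auto simp: localize_def)
  then show ?thesis
    using assms(1,2) unfolding localize_def mult_set_def
    by (auto intro!: bexI[of _ "r * u"] simp: mult.assoc)
qed

lemma localize_mult:
  assumes "\<And>x. x \<in> I \<Longrightarrow> d * x \<in> K" "x \<in> localize U I"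
  shows "d * x \<in> localize U K"
proof -
  obtain r where "r \<in> U" "r * x \<in> I"
    using assms(2) by (auto simp: localize_def)
  then have "r * (d * x) \<in> K"
    using assms(1)[of "r * x"] by (simp add: algebra_simps)
  then show ?thesis
    using \<open>r \<in> U\<close> by (auto simp: localize_def)
qed

text \<open>This is the \<open>n\<close>-th power of the ideal generated by \<open>d\<close> and
  \<open>c\<close>, in a form that splits off one generator at a time.\<close>

fun ideal_power :: "'a::comm_ring_1 \<Rightarrow> 'a \<Rightarrow> nat \<Rightarrow> 'a set" where
  "ideal_power d c 0 = UNIV"
| "ideal_power d c (Suc n) = {d * x + c * y | x y. x \<in> ideal_power d c n \<and> y \<in> ideal_power d c n}"

lemma ring_ideal_power: "ring_ideal (ideal_power d c n)"
proof (induction n)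
  case 0
  show ?case by (simp add: ring_ideal_def)
next
  case (Suc n)
  note I = Suc.IH
  show ?case
    unfolding ring_ideal_def
  proof (intro conjI ballI allI)
    show "0 \<in> ideal_power d c (Suc n)"
      using ring_ideal_zero[OF I] by force
  next
    fix x y assume "x \<in> ideal_power d c (Suc n)" "y \<in> ideal_power d c (Suc n)"
    then obtain x1 x2 y1 y2 where *: "x = d * x1 + c * x2" "y = d * y1 + c * y2"
      "x1 \<in> ideal_power d c n" "x2 \<in> ideal_power d c n" "y1 \<in> ideal_power d c n" "y2 \<in> ideal_power d c n"
      by auto
    have "x + y = d * (x1 + y1) + c * (x2 + y2)"
      by (simp add: * algebra_simps)
    then show "x + y \<in> ideal_power d c (Suc n)"
      using ring_ideal_add[OF I *(3,5)] ring_ideal_add[OF I *(4,6)] by auto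
  next
    fix r x assume "x \<in> ideal_power d c (Suc n)"
    then obtain x1 x2 where *: "x = d * x1 + c * x2" "x1 \<in> ideal_power d c n" "x2 \<in> ideal_power d c n"
      by auto
    have "r * x = d * (r * x1) + c * (r * x2)"
      by (simp add: * algebra_simps)
    then show "r * x \<in> ideal_power d c (Suc n)"
      using ring_ideal_mult[OF I *(2)] ring_ideal_mult[OF I *(3)] by auto
  qed
qed

lemma ideal_power_mult1: "x \<in> ideal_power d c n \<Longrightarrow> d * x \<in> ideal_power d c (Suc n)"
  using ring_ideal_zero[OF ring_ideal_power, of d c n] by force

lemma ideal_power_mult2: "x \<in> ideal_power d c n \<Longrightarrow> c * x \<in> ideal_power d c (Suc n)"
  using ring_ideal_zero[OF ring_ideal_power, of d c n] by force

lemma ideal_power_Suc_subset: "ideal_power d c (Suc n) \<subseteq> ideal_power d c n"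
  by (auto intro!: ring_ideal_add[OF ring_ideal_power] ring_ideal_mult[OF ring_ideal_power])

text \<open>The only monomial of degree \<open>Suc n\<close> in \<open>d\<close> and
  \<open>c\<close> without a factor \<open>c\<close> is the pure power of \<open>d\<close>.\<close>

lemma ideal_power_SucE:
  assumes "x \<in> ideal_power d c (Suc n)"
  obtains t y where "x = d ^ Suc n * t + c * y" "y \<in> ideal_power d c n"
  using assms
proof (induction n arbitrary: x thesis)
  case 0
  then show ?case by auto
next
  case (Suc n)
  obtain x1 x2 where *: "x = d * x1 + c * x2" "x1 \<in> ideal_power d c (Suc n)" "x2 \<in> ideal_power d c (Suc n)"
    using Suc.prems(2) by auto
  obtain t y where **: "x1 = d ^ Suc n * t + c * y" "y \<in> ideal_power d c n"
    using Suc.IH[OF _ *(2)] by blast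
  have "x = d ^ Suc (Suc n) * t + c * (d * y + x2)"
    by (simp add: * ** algebra_simps)
  moreover have "d * y + x2 \<in> ideal_power d c (Suc n)"
    by (rule ring_ideal_add[OF ring_ideal_power ideal_power_mult1[OF **(2)] *(3)])
  ultimately show ?case by (rule Suc.prems(1))
qed

lemma power_mem_ideal_power: "d ^ n \<in> ideal_power d c n"
proof (induction n)
  case (Suc n)
  then show ?case using ideal_power_mult1[of "d ^ n" d c n] by simp
qed simp

text \<open>Eliminating \<open>e\<close> expresses \<open>w (Suc (Suc m))\<close> as \<open>a\<^sup>2 + q m\<close>, a unit with respect to
  the filtration, times \<open>w (Suc m)\<close> plus terms of higher order; the recursion therefore improves
  the order of \<open>w\<close> when it is run downwards from the index \<open>M\<close>.\<close>

lemma order_of_recursion: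
  fixes L :: "nat \<Rightarrow> 'a::comm_ring_1 set"
  assumes L: "\<And>n. ring_ideal (L n)" and L0: "L 0 = UNIV"
    and eps: "\<And>n x. x \<in> L n \<Longrightarrow> eps * x \<in> L (Suc n)"
    and gam: "\<And>n x. x \<in> L n \<Longrightarrow> c * x \<in> L (Suc n)"
    and e: "\<And>m. e (Suc m) = a * w (Suc m) + p m * eps * e m + d m * c * w m"
    and w: "\<And>m. w (Suc (Suc m)) = a * e (Suc m) + q m * w (Suc m) + f m * c * e m"
    and unit: "\<And>m n x. (a ^ 2 + q m) * x \<in> L n \<Longrightarrow> x \<in> L n"
    and top: "\<And>n. w M \<in> L n"
    and nm: "n \<le> m" "m \<le> M"
  shows "e m \<in> L n \<and> w m \<in> L n"
  using nm
proof (induction n arbitrary: m)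
  case 0
  then show ?case by (simp add: L0)
next
  case (Suc n)
  have eps': "r * eps * x \<in> L (Suc n)" if "x \<in> L n" for x r
    using ring_ideal_mult[OF L eps[OF that], of r] by (simp add: mult.assoc)
  have gam': "r * c * x \<in> L (Suc n)" if "x \<in> L n" for x r
    using ring_ideal_mult[OF L gam[OF that], of r] by (simp add: mult.assoc)
  have w_mem: "w m \<in> L (Suc n)" if "m \<le> M" "Suc n \<le> m" for m
    using that
  proof (induction m rule: inc_induct)
    case base
    show ?case by (rule top)
  next
    case (step k)
    obtain i where i: "k = Suc i" "n \<le> i"
      using step.prems by (cases k) auto
    have i_mem: "e i \<in> L n" "w i \<in> L n"
      using Suc.IH[of i] i step.hyps by auto
    have top': "w (Suc k) \<in> L (Suc n)"
      using step.IH step.prems by simp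
    have "(a ^ 2 + q i) * w k = w (Suc k) - (a * p i) * eps * e i - (a * d i) * c * w i - f i * c * e i"
      unfolding i(1) w e[of i] by (simp add: algebra_simps power2_eq_square)
    then have "(a ^ 2 + q i) * w k \<in> L (Suc n)"
      using top' i_mem by (simp add: ring_ideal_diff[OF L] eps' gam')
    then show ?case by (rule unit)
  qed
  have "e m \<in> L (Suc n)"
  proof -
    obtain i where i: "m = Suc i" "n \<le> i"
      using Suc.prems by (cases m) auto
    then have "e i \<in> L n" "w i \<in> L n"
      using Suc.IH[of i] Suc.prems by auto
    then show ?thesis
      unfolding i(1) e using w_mem[of m] Suc.prems i
      by (intro ring_ideal_add[OF L]) (simp_all add: ring_ideal_mult[OF L] eps' gam')
  qed
  then show ?case using w_mem Suc.prems by auto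
qed

text \<open>The index is shifted by one: \<open>zrec \<alpha> \<beta> \<gamma> (Suc k)\<close> is \<open>\<zeta>\<^sub>k\<close>, so that \<open>\<zeta>\<^bsub>-1\<^esub> = 0\<close> is available. The truncated
  \<open>k - 1\<close> at \<open>k = 0\<close> is harmless because of the factor \<open>2 * k * (k - 1)\<close>.\<close>

fun zrec :: "'a::comm_ring_1 \<Rightarrow> 'a \<Rightarrow> 'a \<Rightarrow> nat \<Rightarrow> 'a" where
  "zrec a b c 0 = 0"
| "zrec a b c (Suc 0) = 1"
| "zrec a b c (Suc (Suc k)) = a * zrec a b c (Suc k)
     + of_nat (k ^ 2) * (b + (- 1) ^ k * 8) * zrec a b c k
     + of_nat (2 * k * (k - 1)) * c * zrec a b c (k - 1)"

lemma zeta_eq_zrec: "zeta k = zrec alpha beta gamma (Suc k)"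
proof (induction k rule: less_induct)
  case (less k)
  show ?case
  proof (cases k)
    case (Suc i)
    then show ?thesis
      using less by (auto split: nat.splits)
  qed simp
qed

subsection \<open>The ideals \<open>J\<^sub>g\<close>\<close>

abbreviation Z :: "nat \<Rightarrow> R" where
  "Z \<equiv> zrec alpha beta gamma"

abbreviation D :: R where
  "D \<equiv> beta ^ 2 - 64"

abbreviation J :: "nat \<Rightarrow> R set" where
  "J g \<equiv> Collect (in_J g)"

abbreviation K :: "nat \<Rightarrow> R set" where
  "K \<equiv> ideal_power D gamma"

lemma ring_ideal_J: "ring_ideal (J g)"
  unfolding ring_ideal_def mem_Collect_eq in_J_def
proof (intro conjI ballI allI; (elim CollectE exE)?)
  show "\<exists>a b c. 0 = a * zeta g + b * zeta (g + 1) + c * zeta (g + 2)"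
    by (intro exI[of _ 0]) simp
next
  fix x y :: R and a b c a' b' c'
  assume "x = a * zeta g + b * zeta (g + 1) + c * zeta (g + 2)"
    "y = a' * zeta g + b' * zeta (g + 1) + c' * zeta (g + 2)"
  then have "x + y = (a + a') * zeta g + (b + b') * zeta (g + 1) + (c + c') * zeta (g + 2)"
    by (simp add: algebra_simps del: zeta.simps)
  then show "\<exists>a b c. x + y = a * zeta g + b * zeta (g + 1) + c * zeta (g + 2)" by blast
next
  fix r x :: R and a b c
  assume "x = a * zeta g + b * zeta (g + 1) + c * zeta (g + 2)"
  then have "r * x = (r * a) * zeta g + (r * b) * zeta (g + 1) + (r * c) * zeta (g + 2)"
    by (simp only: distrib_left mult.assoc)
  then show "\<exists>a b c. r * x = a * zeta g + b * zeta (g + 1) + c * zeta (g + 2)" by blast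
qed

lemmas J_add = ring_ideal_add[OF ring_ideal_J]
  and J_mult = ring_ideal_mult[OF ring_ideal_J]
  and J_diff = ring_ideal_diff[OF ring_ideal_J]

text \<open>By the index shift the generators of \<open>J g\<close> are \<open>Z\<close> at
  \<open>g + 1\<close>, \<open>g + 2\<close>, \<open>g + 3\<close>, and each later term is a
  combination of the three terms before it.\<close>

lemma Z_mem_J: "g < k \<Longrightarrow> Z k \<in> J g"
proof (induction k rule: less_induct)
  case (less k)
  consider "k = Suc g" | "k = Suc (Suc g)" | "k = Suc (Suc (Suc g))"
    | i where "k = Suc (Suc i)" "Suc g < i"
    using less.prems by (metis Suc_lessE Suc_lessI)
  then show ?case
  proof cases
    case 1
    have "in_J g (zeta g)"
      unfolding in_J_def by (rule exI[of _ 1], rule exI[of _ 0], rule exI[of _ 0]) simp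
    then show ?thesis by (simp add: 1 zeta_eq_zrec del: zrec.simps)
  next
    case 2
    have "in_J g (zeta (g + 1))"
      unfolding in_J_def by (rule exI[of _ 0], rule exI[of _ 1], rule exI[of _ 0]) simp
    then show ?thesis by (simp add: 2 zeta_eq_zrec del: zrec.simps)
  next
    case 3
    have "in_J g (zeta (g + 2))"
      unfolding in_J_def by (rule exI[of _ 0], rule exI[of _ 0], rule exI[of _ 1]) simp
    then show ?thesis by (simp add: 3 zeta_eq_zrec del: zrec.simps)
  next
    case 4
    have "Z (Suc i) \<in> J g" "Z i \<in> J g" "Z (i - 1) \<in> J g"
      using 4 less.IH by auto
    then show ?thesis
      unfolding 4(1) zrec.simps by (intro J_add J_mult)
  qed
qed

lemma in_J_iff: "in_J g p \<longleftrightarrow> (\<exists>a b c. p = a * Z (g + 1) + b * Z (g + 2) + c * Z (g + 3))"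
  by (simp add: in_J_def zeta_eq_zrec eval_nat_numeral del: zrec.simps)

lemma J_subsetI:
  assumes "ring_ideal I" "Z (g + 1) \<in> I" "Z (g + 2) \<in> I" "Z (g + 3) \<in> I"
  shows "J g \<subseteq> I"
proof
  fix p assume "p \<in> J g"
  then obtain a b c where p: "p = a * Z (g + 1) + b * Z (g + 2) + c * Z (g + 3)"
    by (auto simp: in_J_iff)
  show "p \<in> I"
    unfolding p by (intro ring_ideal_add[OF assms(1)] ring_ideal_mult[OF assms(1)] assms(2-))
qed

lemma J_Suc_subset: "J (Suc g) \<subseteq> J g"
  by (rule J_subsetI[OF ring_ideal_J]) (simp_all add: Z_mem_J del: mem_Collect_eq zrec.simps)

lemma ideal_cancel_of_nat:
  fixes x :: R
  assumes "ring_ideal I" "of_nat n * x \<in> I" "n \<noteq> 0"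
  shows "x \<in> I"
proof -
  have "[:[:[:1 / of_nat n:]:]:] * (of_nat n * x) = x"
    using assms(3) by (simp add: of_nat_poly flip: one_pCons)
  then show ?thesis
    using ring_ideal_mult[OF assms(1,2)] by metis
qed

text \<open>Solve the recursion for its last term: the remaining terms have index above
  \<open>Suc g\<close>, and the integer coefficient is invertible.\<close>

lemma gamma_Z_mem_J: "gamma * Z (Suc g) \<in> J (Suc g)"
proof -
  let ?k = "Suc (Suc g)"
  have "of_nat (2 * ?k * (?k - 1)) * (gamma * Z (Suc g)) =
      Z (Suc (Suc ?k)) - alpha * Z (Suc ?k) - of_nat (?k ^ 2) * (beta + (- 1) ^ ?k * 8) * Z ?k"
    unfolding zrec.simps(3)[of _ _ _ ?k] by (simp add: mult.assoc del: zrec.simps)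
  also have "\<dots> \<in> J (Suc g)"
    by (intro J_diff J_mult Z_mem_J) auto
  finally show ?thesis
    by (rule ideal_cancel_of_nat[OF ring_ideal_J]) simp
qed

text \<open>Only the first generator of \<open>J g\<close> needs an argument; the other two already
  lie in \<open>J (Suc g)\<close>.\<close>

lemma gamma_mult_J:
  assumes "x \<in> J g"
  shows "gamma * x \<in> J (Suc g)"
proof -
  have "ring_ideal {x. gamma * x \<in> J (Suc g)}"
    using ring_ideal_J[of "Suc g"] unfolding ring_ideal_def
    by (auto simp: distrib_left mult.left_commute simp del: mem_Collect_eq) (simp_all add: mult.left_commute)
  then have "J g \<subseteq> {x. gamma * x \<in> J (Suc g)}"
    using gamma_Z_mem_J[of g] J_mult[OF Z_mem_J[of "Suc g"], of _ gamma]
    by (intro J_subsetI) (auto simp del: zrec.simps)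
  with assms show ?thesis by blast
qed

lemma D_factor: "(beta + (- 1) ^ Suc k * 8) * (beta + (- 1) ^ k * 8) = D"
  by (cases "even k") (simp_all add: algebra_simps power2_eq_square)

text \<open>Modulo \<open>gamma\<close> the recursion can be solved for its lowest term; multiplying
  by the opposite factor of \<open>D\<close> shows that each step down in the index costs one
  \<open>D\<close>.\<close>

lemma D_power_Z_mem:
  assumes "0 < k" "g < k + i"
  shows "D ^ i * Z k \<in> ideal_sum (J g) (range ((*) gamma))" (is "_ \<in> ?M")
  using assms
proof (induction i arbitrary: k)
  have gam: "ring_ideal (range ((*) gamma))"
    by (rule ring_ideal_mult_image) (simp add: ring_ideal_def)
  note M = ring_ideal_sum[OF ring_ideal_J[of g] gam]
  {
    case 0
    then show ?case
      using ideal_sum_left[OF gam Z_mem_J[of g k]] by simp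
  next
    case (Suc i)
    let ?b = "beta + (- 1) ^ Suc k * 8"
    have *: "D ^ i * Z (Suc (Suc k)) \<in> ?M" "D ^ i * Z (Suc k) \<in> ?M"
      by (rule Suc.IH; use Suc.prems in simp)+
    have 3: "gamma * (?b * D ^ i * of_nat (2 * k * (k - 1)) * Z (k - 1)) \<in> ?M"
      by (rule ideal_sum_right[OF ring_ideal_J rangeI])
    have "of_nat (k ^ 2) * (D ^ Suc i * Z k) =
        ?b * (D ^ i * Z (Suc (Suc k))) - ?b * alpha * (D ^ i * Z (Suc k))
        - gamma * (?b * D ^ i * of_nat (2 * k * (k - 1)) * Z (k - 1))"
      unfolding zrec.simps(3) power_Suc D_factor[of k, symmetric] by (simp add: algebra_simps)
    also have "\<dots> \<in> ?M"
      by (rule ring_ideal_diff[OF M ring_ideal_diff[OF M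
            ring_ideal_mult[OF M *(1)] ring_ideal_mult[OF M *(2)]] 3])
    finally show ?case
      by (rule ideal_cancel_of_nat[OF M]) (use Suc.prems in simp)
  }
qed

subsection \<open>Local analysis at a common zero\<close>

text \<open>Evaluation at the point \<alpha> = \<open>l\<close>, \<beta> = \<open>c\<close>,
  \<gamma> = 0. It is used with \<open>c ^ 2 = 64\<close>, where \<open>D\<close> vanishes
  too.\<close>

definition ev :: "complex \<Rightarrow> complex \<Rightarrow> R \<Rightarrow> complex" where
  "ev c l p = poly (poly (poly p 0) [:c:]) l"

lemma ev_hom [simp]:
  "ev c l 0 = 0" "ev c l 1 = 1"
  "ev c l (p + q) = ev c l p + ev c l q"
  "ev c l (p - q) = ev c l p - ev c l q"
  "ev c l (- p) = - ev c l p"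
  "ev c l (p * q) = ev c l p * ev c l q"
  "ev c l (p ^ n) = ev c l p ^ n"
  "ev c l (of_nat n) = of_nat n"
  "ev c l (numeral k) = numeral k"
  "ev c l alpha = l" "ev c l beta = c" "ev c l gamma = 0"
  by (simp_all add: ev_def alpha_def beta_def gamma_def)

lemma ev_zrec:
  "ev c l (Z (Suc (Suc k))) = l * ev c l (Z (Suc k)) + of_nat (k ^ 2) * (c + (- 1) ^ k * 8) * ev c l (Z k)"
  by simp

lemma mult_set_ev: "mult_set {r. ev c l r \<noteq> 0}"
  by (simp add: mult_set_def)

text \<open>At a common zero of \<open>J\<^sub>g\<close> with last non-vanishing \<open>\<zeta>\<^sub>j\<close>, the factor \<open>\<beta> + (-1)\<^bsup>j+1\<^esup> 8\<close> vanishes and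
  \<open>\<alpha>\<^sup>2 = -16 (-1)\<^sup>j j\<^sup>2\<close>, which makes the coefficients \<open>\<alpha>\<^sup>2 + q m\<close> of \<open>order_of_recursion\<close> units.\<close>

lemma ev_last:
  assumes c: "c ^ 2 = 64"
    and nz: "ev c l (Z (Suc j)) \<noteq> 0"
    and z: "ev c l (Z (Suc (Suc j))) = 0" "ev c l (Z (Suc (Suc (Suc j)))) = 0"
  shows "c = (- 1) ^ j * 8" "l ^ 2 + of_nat (j ^ 2) * (c + (- 1) ^ j * 8) = 0"
proof -
  have "of_nat ((Suc j) ^ 2) * (c + (- 1) ^ Suc j * 8) = 0"
    using z nz ev_zrec[of c l "Suc j"] by (auto simp del: zrec.simps)
  then have "(of_nat (Suc j) ^ 2 :: complex) * (c - (- 1) ^ j * 8) = 0"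
    by simp
  then show c: "c = (- 1) ^ j * 8"
    by (metis eq_iff_diff_eq_0 mult_eq_0_iff of_nat_eq_0_iff old.nat.distinct(1) power_not_zero)
  show "l ^ 2 + of_nat (j ^ 2) * (c + (- 1) ^ j * 8) = 0"
  proof (cases j)
    case 0
    then show ?thesis using z(1) by simp
  next
    case (Suc i)
    \<comment> \<open>The parities of \<open>i\<close> and \<open>j\<close> differ, so the factor
      \<open>c + (- 1) ^ i * 8\<close> is zero.\<close>
    have 1: "ev c l (Z (Suc j)) = l * ev c l (Z j)"
      using ev_zrec[of c l i] c by (simp add: Suc del: zrec.simps)
    have 2: "l * ev c l (Z (Suc j)) + of_nat (j ^ 2) * (c + (- 1) ^ j * 8) * ev c l (Z j) = 0"
      using z(1) ev_zrec[of c l j] by (simp del: zrec.simps)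
    have "(l ^ 2 + of_nat (j ^ 2) * (c + (- 1) ^ j * 8)) * ev c l (Z (Suc j)) =
       l * (l * ev c l (Z (Suc j)) + of_nat (j ^ 2) * (c + (- 1) ^ j * 8) * ev c l (Z j))"
      unfolding 1 by (simp add: algebra_simps power2_eq_square)
    then show ?thesis using 2 nz by simp
  qed
qed

text \<open>\<open>order_of_recursion\<close> bounds the orders of \<open>e m\<close> and
  \<open>w m\<close>. Up to the errors allowed here, the recursion then makes
  \<open>e (Suc m)\<close> a unit times \<open>D * e m\<close>, which links \<open>e n\<close> in
  the ideal to the unit \<open>e 0\<close>.\<close>

lemma D_power_local:
  assumes c: "c ^ 2 = 64" and n: "n \<ge> 1"
  shows "D ^ n \<in> localize {r. ev c l r \<noteq> 0}
    (ideal_sum (J (Suc n)) (ideal_sum ((*) gamma ` K (n - 1)) (K (Suc n))))"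
proof -
  let ?J = "J (Suc n)"
  define U where "U = {r. ev c l r \<noteq> 0}"
  \<comment> \<open>\<open>L m\<close> measures the order in \<open>D\<close> and
    \<open>gamma\<close>. In degree \<open>m + 1\<close>, \<open>G m\<close> absorbs every monomial
    except the pure power of \<open>D\<close>, and it absorbs everything of degree
    \<open>m + 2\<close>.\<close>
  define L where "L m = localize U (ideal_sum ?J (K m))" for m
  define G where "G m = localize U (ideal_sum ?J (ideal_sum ((*) gamma ` K m) (K (Suc (Suc m)))))" for m
  have U: "mult_set U"
    unfolding U_def by (rule mult_set_ev)
  have gK: "ring_ideal ((*) gamma ` K m)" for m
    by (intro ring_ideal_mult_image ring_ideal_power)
  have gKK: "ring_ideal (ideal_sum ((*) gamma ` K m) (K (Suc (Suc m))))" for m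
    by (intro ring_ideal_sum gK ring_ideal_power)
  have L: "ring_ideal (L m)" for m
    unfolding L_def by (intro ring_ideal_localize U ring_ideal_sum ring_ideal_J ring_ideal_power)
  have G: "ring_ideal (G m)" for m
    unfolding G_def by (intro ring_ideal_localize U ring_ideal_sum ring_ideal_J gKK)
  have J_G: "x \<in> G m" if "x \<in> ?J" for x m
    unfolding G_def by (intro localize_incl[OF U] ideal_sum_left[OF gKK] that)
  have J_L: "x \<in> L m" if "x \<in> ?J" for x m
    unfolding L_def by (intro localize_incl[OF U] ideal_sum_left[OF ring_ideal_power] that)
  have gamma_L_G: "gamma * x \<in> G m" if "x \<in> L m" for x m
    using that unfolding L_def G_def
  proof (rule localize_mult[rotated])
    fix x assume "x \<in> ideal_sum ?J (K m)"
    then obtain y k where *: "x = y + k" "y \<in> ?J" "k \<in> K m"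
      by (auto simp: ideal_sum_def)
    show "gamma * x \<in> ideal_sum ?J (ideal_sum ((*) gamma ` K m) (K (Suc (Suc m))))"
      unfolding *(1) distrib_left
      by (intro ideal_sumI J_mult *(2) ideal_sum_left[OF ring_ideal_power] imageI *(3))
  qed
  have L_G: "x \<in> G m" if "x \<in> L (Suc (Suc m))" for x m
  proof -
    have "1 * x \<in> G m"
      using that unfolding L_def G_def
    proof (rule localize_mult[rotated])
      fix x assume "x \<in> ideal_sum ?J (K (Suc (Suc m)))"
      then obtain y k where *: "x = y + k" "y \<in> ?J" "k \<in> K (Suc (Suc m))"
        by (auto simp: ideal_sum_def simp del: ideal_power.simps)
      show "1 * x \<in> ideal_sum ?J (ideal_sum ((*) gamma ` K m) (K (Suc (Suc m))))"
        unfolding *(1) mult_1 by (intro ideal_sumI *(2) ideal_sum_right[OF gK] *(3))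
    qed
    then show ?thesis by simp
  qed
  have gamma_L: "gamma * x \<in> L (Suc m)" if "x \<in> L m" for x m
    using that unfolding L_def
  proof (rule localize_mult[rotated])
    fix x assume "x \<in> ideal_sum ?J (K m)"
    then obtain y k where *: "x = y + k" "y \<in> ?J" "k \<in> K m"
      by (auto simp: ideal_sum_def)
    show "gamma * x \<in> ideal_sum ?J (K (Suc m))"
      unfolding *(1) distrib_left by (intro ideal_sumI J_mult *(2) ideal_power_mult2 *(3))
  qed
  have D_L: "D * x \<in> L (Suc m)" if "x \<in> L m" for x m
    using that unfolding L_def
  proof (rule localize_mult[rotated])
    fix x assume "x \<in> ideal_sum ?J (K m)"
    then obtain y k where *: "x = y + k" "y \<in> ?J" "k \<in> K m"
      by (auto simp: ideal_sum_def)
    show "D * x \<in> ideal_sum ?J (K (Suc m))"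
      unfolding *(1) distrib_left by (intro ideal_sumI J_mult *(2) ideal_power_mult1 *(3))
  qed
  have D_G: "D * x \<in> G (Suc m)" if "x \<in> G m" for x m
    using that unfolding G_def
  proof (rule localize_mult[rotated])
    fix x assume "x \<in> ideal_sum ?J (ideal_sum ((*) gamma ` K m) (K (Suc (Suc m))))"
    then obtain y k k' where *: "x = y + (gamma * k + k')" "y \<in> ?J" "k \<in> K m" "k' \<in> K (Suc (Suc m))"
      by (auto simp: ideal_sum_def simp del: ideal_power.simps)
    have "D * x = D * y + (gamma * (D * k) + D * k')"
      unfolding *(1) by (simp only: distrib_left mult.left_commute[of D gamma])
    also have "\<dots> \<in> ideal_sum ?J (ideal_sum ((*) gamma ` K (Suc m)) (K (Suc (Suc (Suc m)))))"
      by (intro ideal_sumI J_mult *(2) imageI ideal_power_mult1 *(3,4))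
    finally show "D * x \<in> ideal_sum ?J (ideal_sum ((*) gamma ` K (Suc m)) (K (Suc (Suc (Suc m)))))" .
  qed
  have cancel_L: "x \<in> L m" if "ev c l u \<noteq> 0" "u * x \<in> L m" for u x m
    using localize_cancel[OF U, of u x] that by (simp add: L_def U_def)
  have cancel_G: "x \<in> G m" if "ev c l u \<noteq> 0" "u * x \<in> G m" for u x m
    using localize_cancel[OF U, of u x] that by (simp add: G_def U_def)
  have "D ^ n \<in> G (n - 1)"
  proof (cases "\<exists>k > Suc n. ev c l (Z k) \<noteq> 0")
    \<comment> \<open>A member of the ideal that does not vanish at the point is a unit of the
      localization, so the localized ideal is everything.\<close>
    case True
    then obtain k where k: "k > Suc n" "ev c l (Z k) \<noteq> 0" by blast
    have "Z k * D ^ n \<in> G (n - 1)"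
      using J_mult[OF Z_mem_J[OF k(1)], of "D ^ n"] by (intro J_G) (simp add: mult.commute)
    then show ?thesis using cancel_G k(2) by blast
  next
    case False
    define j where "j = Greatest (\<lambda>j. ev c l (Z (Suc j)) \<noteq> 0)"
    have ex: "ev c l (Z (Suc 0)) \<noteq> 0" by simp
    have bd: "k \<le> n" if "ev c l (Z (Suc k)) \<noteq> 0" for k
      using False that by (meson Suc_less_eq not_le)
    have nz: "ev c l (Z (Suc j)) \<noteq> 0"
      unfolding j_def using bd ex by (rule GreatestI_nat[rotated])
    have z: "ev c l (Z (Suc k)) = 0" if "k > j" for k
      using Greatest_le_nat[of "\<lambda>j. ev c l (Z (Suc j)) \<noteq> 0", OF _ bd] that
      unfolding j_def by (meson not_le)
    note last = ev_last[OF c nz z[of "Suc j"] z[of "Suc (Suc j)"], simplified]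
    \<comment> \<open>Of the two factors of \<open>D\<close>, \<open>eps\<close> vanishes at the
      point and \<open>b\<close> does not; locally \<open>eps\<close> can replace
      \<open>D\<close>.\<close>
    define eps where "eps = beta + (- 1) ^ Suc j * 8"
    define b where "b = beta + (- 1) ^ j * 8"
    have D_eq: "D = b * eps"
      using D_factor[of j] by (simp add: eps_def b_def mult.commute)
    have b_nz: "ev c l b \<noteq> 0"
      by (simp add: b_def last(1))
    define e where "e m = Z (Suc (j + 2 * m))" for m
    define w where "w m = Z (j + 2 * m)" for m
    define p :: "nat \<Rightarrow> R" where "p m = of_nat ((j + 2 * m + 1) ^ 2)" for m
    define q :: "nat \<Rightarrow> R" where "q m = of_nat ((j + 2 * m + 2) ^ 2) * b" for m
    define d :: "nat \<Rightarrow> R" where "d m = of_nat (2 * (j + 2 * m + 1) * (j + 2 * m))" for m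
    define f :: "nat \<Rightarrow> R" where "f m = of_nat (2 * (j + 2 * m + 2) * (j + 2 * m + 1))" for m
    have e_rec: "e (Suc m) = alpha * w (Suc m) + p m * eps * e m + d m * gamma * w m" for m
      using zrec.simps(3)[of alpha beta gamma "Suc (j + 2 * m)"]
      by (simp add: e_def w_def p_def d_def eps_def power_add power_mult del: zrec.simps)
    have w_rec: "w (Suc (Suc m)) = alpha * e (Suc m) + q m * w (Suc m) + f m * gamma * e m" for m
      using zrec.simps(3)[of alpha beta gamma "Suc (Suc (j + 2 * m))"]
      by (simp add: e_def w_def q_def f_def b_def power_add power_mult mult.assoc del: zrec.simps)
    have eps_L: "eps * x \<in> L (Suc m)" if "x \<in> L m" for x m
      using cancel_L[OF b_nz, of "eps * x"] D_L[OF that] by (simp add: D_eq mult.assoc)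
    have eps_G: "eps * x \<in> G (Suc m)" if "x \<in> G m" for x m
      using cancel_G[OF b_nz, of "eps * x"] D_G[OF that] by (simp add: D_eq mult.assoc)
    \<comment> \<open>By \<open>ev_last\<close>, \<open>l ^ 2\<close> is \<open>- (j ^ 2)\<close>
      times the value of \<open>b\<close>, so the value is that of \<open>b\<close> times the
      nonzero number \<open>(j + 2 * m + 2) ^ 2 - j ^ 2\<close>.\<close>
    have unit: "ev c l (alpha ^ 2 + q m) \<noteq> 0" for m
    proof
      assume "ev c l (alpha ^ 2 + q m) = 0"
      then have "l ^ 2 + of_nat ((j + 2 * m + 2) ^ 2) * (c + (- 1) ^ j * 8) = 0"
        by (simp add: q_def b_def)
      with last(2) have "(of_nat ((j + 2 * m + 2) ^ 2) :: complex) = of_nat (j ^ 2)"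
        using b_nz by (simp add: b_def) (metis add_left_cancel mult_right_cancel)
      then have "(j + 2 * m + 2) ^ 2 = j ^ 2"
        by (simp only: of_nat_eq_iff)
      then show False by simp
    qed
    have ord: "e m \<in> L m \<and> w m \<in> L m" if "m \<le> Suc (Suc n)" for m
    proof (rule order_of_recursion[of L eps gamma e alpha w p d q f "Suc (Suc n)"])
      show "L 0 = UNIV"
      proof -
        have "x \<in> L 0" for x
          unfolding L_def by (intro localize_incl[OF U] ideal_sum_right[OF ring_ideal_J]) simp
        then show ?thesis by blast
      qed
      show "w (Suc (Suc n)) \<in> L m" for m
        unfolding w_def by (intro J_L Z_mem_J) simp
      show "x \<in> L k" if "(alpha ^ 2 + q m) * x \<in> L k" for m k x
        using cancel_L[OF unit that] .
    qed (use that in \<open>simp_all add: L eps_L gamma_L e_rec w_rec\<close>)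
    \<comment> \<open>Descend from \<open>e n\<close>, which lies in the ideal because
      \<open>n \<ge> 1\<close>. Eliminating \<open>w (Suc m)\<close> expresses
      \<open>eps * e m\<close> through \<open>e (Suc m)\<close>, up to units and the error
      \<open>?rest\<close> in \<open>G m\<close>.\<close>
    have eps_e: "eps ^ i * e (n - i) \<in> G (n - 1)" if "i \<le> n" for i
      using that
    proof (induction i)
      case 0
      have "e n \<in> ?J"
        unfolding e_def by (rule Z_mem_J) (use n in simp)
      then show ?case by (simp add: J_G)
    next
      case (Suc i)
      define m where "m = n - Suc i"
      have m: "n - i = Suc m" "m + i = n - 1"
        using Suc.prems by (auto simp: m_def)
      let ?rest = "alpha * w (Suc (Suc m)) + q m * d m * (gamma * w m) - alpha * f m * (gamma * e m)"
      have rest: "?rest \<in> G m"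
        using ord[of m] ord[of "Suc (Suc m)"] m
        by (intro ring_ideal_add[OF G] ring_ideal_diff[OF G] ring_ideal_mult[OF G] L_G gamma_L_G) auto
      have "eps ^ i * ?rest \<in> G (m + i)"
      proof (induction i)
        case 0
        then show ?case using rest by simp
      next
        case (Suc i)
        then show ?case using eps_G by (simp add: mult.assoc)
      qed
      then have rest': "eps ^ i * ?rest \<in> G (n - 1)"
        by (simp add: m)
      have "(p m * q m) * (eps ^ Suc i * e m) = (alpha ^ 2 + q m) * (eps ^ i * e (Suc m)) - eps ^ i * ?rest"
        unfolding e_rec w_rec by (simp add: algebra_simps power2_eq_square)
      also have "\<dots> \<in> G (n - 1)"
        by (rule ring_ideal_diff[OF G ring_ideal_mult[OF G] rest']) (use Suc m in simp)
      finally have "(p m * q m) * (eps ^ Suc i * e m) \<in> G (n - 1)" .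
      moreover have "ev c l (p m * q m) \<noteq> 0"
      proof -
        have "(of_nat (j + 2 * m + 1) :: complex) \<noteq> 0" "(of_nat (j + 2 * m + 2) :: complex) \<noteq> 0"
          by (simp_all only: of_nat_eq_0_iff)
        then show ?thesis
          using b_nz by (simp only: p_def q_def ev_hom of_nat_power) simp
      qed
      ultimately have "eps ^ Suc i * e m \<in> G (n - 1)"
        by (rule cancel_G[rotated])
      then show ?case by (simp only: m_def)
    qed
    have "e 0 * eps ^ n \<in> G (n - 1)"
      using eps_e[of n] by (simp add: mult.commute)
    then have "eps ^ n \<in> G (n - 1)"
      using cancel_G[of "e 0"] nz by (simp add: e_def)
    then show ?thesis
      unfolding D_eq power_mult_distrib by (rule ring_ideal_mult[OF G])
  qed
  then show ?thesis
    using n by (simp add: G_def U_def)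
qed

section \<open>From local to global membership\<close>

lemma poly_ideal_no_root:
  fixes I :: "complex poly set"
  assumes I: "ring_ideal I" and nr: "\<And>l. \<exists>q\<in>I. poly q l \<noteq> 0"
  shows "1 \<in> I"
proof -
  have "\<exists>q. q \<in> I \<and> q \<noteq> 0"
    using nr[of 0] by force
  then obtain q where q: "q \<in> I" "q \<noteq> 0" and min: "\<And>p. p \<in> I \<Longrightarrow> p \<noteq> 0 \<Longrightarrow> degree q \<le> degree p"
    using ex_has_least_nat[of "\<lambda>q. q \<in> I \<and> q \<noteq> 0" _ degree] by blast
  \<comment> \<open>A root of \<open>q\<close> would be a common root: reducing any member modulo
    \<open>q\<close> gives a member of smaller degree, hence zero.\<close>
  have "degree q = 0"
  proof (rule ccontr)
    assume "degree q \<noteq> 0"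
    then obtain l where l: "poly q l = 0"
      using fundamental_theorem_of_algebra[of q] constant_degree[of q] by auto
    obtain p where p: "p \<in> I" "poly p l \<noteq> 0"
      using nr by blast
    have "p mod q = p - (p div q) * q"
      by (simp add: minus_div_mult_eq_mod)
    then have "p mod q \<in> I"
      using ring_ideal_diff[OF I p(1) ring_ideal_mult[OF I q(1)]] by simp
    moreover have "p mod q \<noteq> 0"
      using p(2) l by (auto simp: mod_eq_0_iff_dvd dvd_def)
    ultimately have "degree q \<le> degree (p mod q)"
      by (rule min)
    moreover have "degree (p mod q) < degree q"
      using \<open>p mod q \<noteq> 0\<close> q(2) degree_mod_less by blast
    ultimately show False by simp
  qed
  then obtain x where x: "q = [:x:]" "x \<noteq> 0"
    using q(2) by (metis degree_eq_zeroE pCons_0_0)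
  have "[:1 / x:] * q = 1"
    using x by (simp add: one_pCons)
  with ring_ideal_mult[OF I q(1), of "[:1 / x:]"] show ?thesis by simp
qed

lemma gamma_dvd_iff: "gamma dvd p \<longleftrightarrow> poly p 0 = 0"
  using poly_eq_0_iff_dvd[of p 0] by (simp add: gamma_def)

lemma line_vanish:
  fixes p :: R
  assumes "poly (poly p 0) [:c:] = 0"
  obtains x y where "p = (beta - [:[:[:c:]:]:]) * x + gamma * y"
proof -
  have "[:- [:c:], 1:] dvd poly p 0"
    using assms by (simp add: poly_eq_0_iff_dvd)
  then obtain q where q: "poly p 0 = [:- [:c:], 1:] * q"
    by (auto simp: dvd_def)
  have "poly (p - (beta - [:[:[:c:]:]:]) * [:q:]) 0 = 0"
    by (simp add: q beta_def)
  then obtain y where "p - (beta - [:[:[:c:]:]:]) * [:q:] = gamma * y"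
    unfolding gamma_dvd_iff[symmetric] by (rule dvdE)
  then show ?thesis
    using that[of "[:q:]" y] by (simp add: algebra_simps)
qed

text \<open>A Nullstellensatz for ideals supported on the two lines \<beta> = 8 and \<beta> = -8 in
  \<gamma> = 0. The one-variable case on each line shows that 1 is congruent to an element of the
  ideal of that line. The product \<open>u\<close> of the two elements lies in the ideal of
  \<open>D\<close> and \<open>gamma\<close>, so it is both 1 and nilpotent modulo
  \<open>I\<close>.\<close>

lemma common_zero_on_lines:
  assumes I: "ring_ideal I" and gam: "gamma \<in> I" and D: "D ^ N \<in> I"
    and nz: "\<And>c l. c ^ 2 = 64 \<Longrightarrow> \<exists>r\<in>I. ev c l r \<noteq> 0"
  shows "1 \<in> I"
proof -
  have line: "\<exists>x y. 1 - ((beta - [:[:[:c:]:]:]) * x + gamma * y) \<in> I" if c: "c ^ 2 = 64" for c :: complex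
  proof -
    have "ring_ideal ((\<lambda>p. poly (poly p 0) [:c:]) ` I)"
      unfolding ring_ideal_def
    proof (intro conjI ballI allI; (elim imageE)?)
      show "0 \<in> (\<lambda>p. poly (poly p 0) [:c:]) ` I"
        using ring_ideal_zero[OF I] by force
    next
      fix x y a b assume "x = poly (poly a 0) [:c:]" "y = poly (poly b 0) [:c:]" "a \<in> I" "b \<in> I"
      then show "x + y \<in> (\<lambda>p. poly (poly p 0) [:c:]) ` I"
        using ring_ideal_add[OF I] by (intro image_eqI[of _ _ "a + b"]) auto
    next
      fix r x a assume "x = poly (poly a 0) [:c:]" "a \<in> I"
      then show "r * x \<in> (\<lambda>p. poly (poly p 0) [:c:]) ` I"
        by (intro image_eqI[OF _ ring_ideal_mult[OF I, of a "[:[:r:]:]"]]) auto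
    qed
    moreover have "\<exists>q\<in>(\<lambda>p. poly (poly p 0) [:c:]) ` I. poly q l \<noteq> 0" for l
      using nz[OF c, of l] by (auto simp: ev_def)
    ultimately have "1 \<in> (\<lambda>p. poly (poly p 0) [:c:]) ` I"
      by (rule poly_ideal_no_root)
    then obtain r where r: "r \<in> I" "poly (poly r 0) [:c:] = 1" by auto
    then have "poly (poly (1 - r) 0) [:c:] = 0" by simp
    then obtain x y where xy: "1 - r = (beta - [:[:[:c:]:]:]) * x + gamma * y"
      by (rule line_vanish)
    have "1 - (1 - r) \<in> I"
      using r(1) by simp
    then show ?thesis
      unfolding xy by blast
  qed
  have c8: "[:[:[:8:]:]:] = (8 :: R)" "[:[:[:-8:]:]:] = (- 8 :: R)"
    by (simp_all add: numeral_poly)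
  obtain x y x' y' where
    1: "1 - ((beta - 8) * x + gamma * y) \<in> I" and 2: "1 - ((beta + 8) * x' + gamma * y') \<in> I"
    using line[of 8] line[of "-8"] unfolding c8 by auto
  define u where "u = ((beta - 8) * x + gamma * y) * ((beta + 8) * x' + gamma * y')"
  have "1 - u = (1 - ((beta - 8) * x + gamma * y)) + ((beta - 8) * x + gamma * y) * (1 - ((beta + 8) * x' + gamma * y'))"
    by (simp add: u_def algebra_simps)
  then have u1: "1 - u \<in> I"
    using ring_ideal_add[OF I 1 ring_ideal_mult[OF I 2]] by (simp only:)
  obtain v where v: "u = D * (x * x') + gamma * v"
  proof
    show "u = D * (x * x') + gamma * ((beta - 8) * x * y' + y * ((beta + 8) * x' + gamma * y'))"
      by (simp add: u_def algebra_simps power2_eq_square)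
  qed
  have "u - D * (x * x') \<in> I"
    using ring_ideal_mult[OF I gam, of v] by (simp add: v mult.commute)
  then have "u ^ N - (D * (x * x')) ^ N \<in> I"
    by (rule ring_ideal_power_diff[OF I])
  moreover have "(D * (x * x')) ^ N \<in> I"
    using ring_ideal_mult[OF I D, of "(x * x') ^ N"] by (simp add: power_mult_distrib mult.commute)
  ultimately have "(u ^ N - (D * (x * x')) ^ N) + (D * (x * x')) ^ N \<in> I"
    by (rule ring_ideal_add[OF I])
  then have uN: "u ^ N \<in> I" by simp
  have "1 ^ N - u ^ N \<in> I"
    using u1 by (rule ring_ideal_power_diff[OF I])
  from ring_ideal_add[OF I this uN] show ?thesis by simp
qed

lemma D_power_mem_sum:
  assumes n: "n \<ge> 1"
  shows "D ^ n \<in> ideal_sum (J (Suc n)) ((*) gamma ` K (n - 1))" (is "_ \<in> ?M")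
proof -
  have gK: "ring_ideal ((*) gamma ` K m)" for m
    by (intro ring_ideal_mult_image ring_ideal_power)
  have M: "ring_ideal ?M"
    by (intro ring_ideal_sum ring_ideal_J gK)
  have nn: "Suc (n - 1) = n" using n by simp
  have gM: "gamma * x \<in> ?M" if "x \<in> K (n - 1)" for x
    by (intro ideal_sum_right[OF ring_ideal_J] imageI that)
  \<comment> \<open>The claim is that this colon ideal is the unit ideal. It contains
    \<open>gamma\<close> and \<open>D ^ Suc n\<close>, so only the points on the two lines have to
    be excluded.\<close>
  define B where "B = {r. r * D ^ n \<in> ?M}"
  have "1 \<in> B"
  proof (rule common_zero_on_lines)
    show "ring_ideal B"
      using M unfolding B_def ring_ideal_def by (auto simp: distrib_right mult.assoc)
    have "gamma * D ^ n \<in> ?M"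
      using power_mem_ideal_power[of D n gamma] ideal_power_Suc_subset[of D gamma "n - 1"] nn
      by (intro gM) auto
    then show "gamma \<in> B" by (simp add: B_def)
    obtain y r where "D ^ Suc n = y + gamma * r" "y \<in> J (Suc n)"
      using D_power_Z_mem[of 1 "Suc n" "Suc n"] by (auto simp: ideal_sum_def)
    then have "D ^ Suc n * D ^ n = D ^ n * y + gamma * (r * D ^ n)"
      by (simp only: distrib_left distrib_right ac_simps)
    also have "D ^ n * y + gamma * (r * D ^ n) = D ^ n * y + gamma * (r * D * D ^ (n - 1))"
      using power_Suc[of D "n - 1"] by (simp only: nn mult.assoc)
    also have "\<dots> \<in> ?M"
      by (intro ring_ideal_add[OF M] gM ring_ideal_mult[OF ring_ideal_power] power_mem_ideal_power
          ideal_sum_left[OF gK] J_mult \<open>y \<in> J (Suc n)\<close>)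
    finally show "D ^ Suc n \<in> B" by (simp add: B_def)
    show "\<exists>r\<in>B. ev c l r \<noteq> 0" if c: "c ^ 2 = 64" for c l
    proof -
      obtain r y k k' where *: "ev c l r \<noteq> 0" "r * D ^ n = y + (gamma * k + k')"
        "y \<in> J (Suc n)" "k \<in> K (n - 1)" "k' \<in> K (Suc n)"
        using D_power_local[OF c n, of l] by (auto simp: localize_def ideal_sum_def simp del: ideal_power.simps)
      \<comment> \<open>The pure power is moved to the left-hand side; \<open>r - D * t\<close> has
        the same value at the point as \<open>r\<close> because \<open>D\<close> vanishes
        there.\<close>
      obtain t z where z: "k' = D ^ Suc n * t + gamma * z" "z \<in> K n"
        using *(5) by (rule ideal_power_SucE)
      have "z \<in> K (n - 1)"
        using z(2) ideal_power_Suc_subset[of D gamma "n - 1"] nn by auto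
      have "(r - D * t) * D ^ n = y + gamma * (k + z)"
        using *(2) z(1) by (simp add: algebra_simps)
      also have "\<dots> \<in> ?M"
        by (intro ideal_sumI *(3) imageI ring_ideal_add[OF ring_ideal_power] *(4) \<open>z \<in> K (n - 1)\<close>)
      finally have "r - D * t \<in> B" by (simp add: B_def)
      moreover have "ev c l (r - D * t) \<noteq> 0"
        using *(1) c by simp
      ultimately show ?thesis by blast
    qed
  qed
  then show ?thesis by (simp add: B_def)
qed

subsection \<open>Reflection symmetry and the upper bound\<close>

text \<open>The evaluation homomorphism sending \<alpha>, \<beta>, \<gamma> to \<open>a\<close>,
  \<open>b\<close>, \<open>c\<close> and constants through \<open>f\<close>.\<close>

definition subst :: "(complex \<Rightarrow> 'a::comm_ring_1) \<Rightarrow> 'a \<Rightarrow> 'a \<Rightarrow> 'a \<Rightarrow> R \<Rightarrow> 'a" where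
  "subst f a b c p = poly (map_poly (\<lambda>q. poly (map_poly (\<lambda>r. poly (map_poly f r) a) q) b) p) c"

definition ring_hom :: "('a::comm_ring_1 \<Rightarrow> 'b::comm_ring_1) \<Rightarrow> bool" where
  "ring_hom f \<longleftrightarrow> f 0 = 0 \<and> f 1 = 1 \<and> (\<forall>x y. f (x + y) = f x + f y) \<and> (\<forall>x y. f (x * y) = f x * f y)"

lemma ring_hom_poly_map_poly:
  assumes "ring_hom f"
  shows "ring_hom (\<lambda>p. poly (map_poly f p) x)"
proof -
  have f: "f 0 = 0" "f 1 = 1" "\<And>x y. f (x + y) = f x + f y" "\<And>x y. f (x * y) = f x * f y"
    using assms by (auto simp: ring_hom_def)
  have add: "map_poly f (p + q) = map_poly f p + map_poly f q" for p q
    by (rule poly_eqI) (simp add: coeff_map_poly f)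
  have smult: "map_poly f (smult c p) = smult (f c) (map_poly f p)" for c p
    by (rule poly_eqI) (simp add: coeff_map_poly f)
  have mult: "map_poly f (p * q) = map_poly f p * map_poly f q" for p q
    by (induction p) (simp_all add: add smult map_poly_pCons f)
  show ?thesis
    by (simp add: ring_hom_def add mult f)
qed

lemma ring_hom_subst:
  assumes "ring_hom f"
  shows "ring_hom (subst f a b c)"
  unfolding subst_def by (intro ring_hom_poly_map_poly assms)

context
  fixes h :: "'a::comm_ring_1 \<Rightarrow> 'b::comm_ring_1"
  assumes h: "ring_hom h"
begin

lemma ring_hom_simps:
  "h 0 = 0" "h 1 = 1" "h (x + y) = h x + h y" "h (x * y) = h x * h y"
  using h by (auto simp: ring_hom_def)

lemma ring_hom_minus: "h (- x) = - h x"
  using ring_hom_simps(3)[of x "- x"] by (simp add: ring_hom_simps(1) add_eq_0_iff)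

lemma ring_hom_diff: "h (x - y) = h x - h y"
  using ring_hom_simps(3)[of x "- y"] by (simp add: ring_hom_minus)

lemma ring_hom_of_nat: "h (of_nat n) = of_nat n"
  by (induction n) (simp_all add: ring_hom_simps)

lemma ring_hom_numeral: "h (numeral k) = numeral k"
  using ring_hom_of_nat[of "numeral k"] by simp

lemma ring_hom_power: "h (x ^ n) = h x ^ n"
  by (induction n) (simp_all add: ring_hom_simps)

lemma ring_hom_zrec: "h (zrec a b c k) = zrec (h a) (h b) (h c) k"
  by (induction a b c k rule: zrec.induct)
    (simp_all add: ring_hom_simps ring_hom_minus ring_hom_diff ring_hom_of_nat ring_hom_numeral ring_hom_power)

end

lemma subst_generators:
  assumes "ring_hom f"
  shows "subst f a b c alpha = a" "subst f a b c beta = b" "subst f a b c gamma = c"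
  using assms by (simp_all add: subst_def alpha_def beta_def gamma_def map_poly_pCons ring_hom_def)

text \<open>Count \<alpha> and \<gamma> as odd and \<beta> as even. The recursion lowers the index
  by 1, 2, 3 with odd, even, odd coefficients, so the parity follows the index.\<close>

lemma zrec_uminus: "zrec (- a) b (- c) (Suc k) = (- 1) ^ k * zrec a b c (Suc k)"
proof (induction k rule: less_induct)
  case (less k)
  consider "k = 0" | "k = 1" | i where "k = Suc (Suc i)"
    by (metis One_nat_def not0_implies_Suc)
  then show ?case
  proof cases
    case 3
    have "zrec (- a) b (- c) (Suc i) = (- 1) ^ i * zrec a b c (Suc i)"
      "zrec (- a) b (- c) (Suc (Suc i)) = (- 1) ^ Suc i * zrec a b c (Suc (Suc i))"
      using less.IH[of i] less.IH[of "Suc i"] 3 by auto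
    moreover have "of_nat (2 * Suc i * (Suc i - 1)) * (- c) * zrec (- a) b (- c) i =
        (- 1) ^ i * (of_nat (2 * Suc i * (Suc i - 1)) * c * zrec a b c i)"
    proof (cases i)
      case (Suc l)
      have "zrec (- a) b (- c) (Suc l) = (- 1) ^ l * zrec a b c (Suc l)"
        using less.IH[of l] 3 Suc by simp
      then show ?thesis by (simp add: Suc del: zrec.simps)
    qed simp
    ultimately show ?thesis
      unfolding 3 zrec.simps(3)[of _ _ _ "Suc i"]
      by (simp add: algebra_simps del: zrec.simps)
  qed simp_all
qed

lemma J_reflection:
  assumes "p \<in> J g"
  shows "subst (\<lambda>x. [:[:[:x:]:]:]) (- alpha) beta (- gamma) p \<in> J g"
proof -
  have f: "ring_hom (\<lambda>x. [:[:[:x:]:]:] :: R)"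
    by (simp add: ring_hom_def one_pCons)
  define h where "h = subst (\<lambda>x. [:[:[:x:]:]:]) (- alpha) beta (- gamma)"
  have h: "ring_hom h"
    unfolding h_def by (rule ring_hom_subst[OF f])
  have gens: "h alpha = - alpha" "h beta = beta" "h gamma = - gamma"
    unfolding h_def by (rule subst_generators[OF f])+
  have hZ: "h (Z (Suc k)) \<in> J g" if "k \<ge> g" for k
    unfolding ring_hom_zrec[OF h] gens zrec_uminus
    by (intro J_mult Z_mem_J) (use that in simp)
  have "ring_ideal {p. h p \<in> J g}"
    using ring_ideal_J[of g] unfolding ring_ideal_def by (simp add: ring_hom_simps[OF h])
  then have "J g \<subseteq> {p. h p \<in> J g}"
    by (rule J_subsetI) (use hZ[of g] hZ[of "Suc g"] hZ[of "Suc (Suc g)"] in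
      \<open>simp_all add: eval_nat_numeral del: zrec.simps\<close>)
  with assms show ?thesis by (auto simp: h_def)
qed

text \<open>\<open>D_power_mem_sum\<close> trades the pure power of \<open>D\<close> for a multiple
  of \<open>gamma\<close>; the cofactor of \<open>gamma\<close> has order one less, and
  multiplication by \<open>gamma\<close> raises the index of \<open>J\<close>, so induction
  applies.\<close>

lemma K_power_mem:
  assumes "x \<in> K n"
  shows "\<exists>c. x - [:[:[:c:]:]:] * gamma ^ n \<in> J (Suc n)"
  using assms
proof (induction n arbitrary: x)
  case 0
  have a: "alpha \<in> J (Suc 0)"
    using Z_mem_J[of "Suc 0" "Suc (Suc 0)"] by simp
  have b: "beta - 8 \<in> J (Suc 0)"
    using J_diff[OF Z_mem_J[of "Suc 0" "Suc (Suc (Suc 0))"] J_mult[OF a, of alpha]] by simp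
  have "[:[:[:1:]:]:] \<in> J 0"
    using Z_mem_J[of 0 "Suc 0"] by (simp flip: one_pCons)
  then have c: "gamma \<in> J (Suc 0)"
    using gamma_mult_J[of 1 0] by (simp flip: one_pCons)
  have c8: "[:[:[:8:]:]:] = (8 :: R)"
    by (simp add: numeral_poly)
  \<comment> \<open>As \<open>J 1\<close> contains \<alpha>, \<beta> - 8 and \<gamma>, the constant
    is the value of \<open>x\<close> at (0, 8, 0).\<close>
  define r where "r = poly (poly x 0) [:8:]"
  have "poly (poly (x - [:[:r:]:]) 0) [:8:] = 0"
    by (simp add: r_def)
  then obtain y z where yz: "x - [:[:r:]:] = (beta - [:[:[:8:]:]:]) * y + gamma * z"
    by (rule line_vanish)
  have "[:- 0, 1:] dvd r - [:poly r 0:]"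
    by (simp only: poly_eq_0_iff_dvd[symmetric]) simp
  then obtain r' where r': "r - [:poly r 0:] = [:0, 1:] * r'"
    by (auto simp: dvd_def)
  then have ra: "[:[:r:]:] - [:[:[:poly r 0:]:]:] = alpha * [:[:r':]:]"
    by (simp add: alpha_def)
  have "x - [:[:[:poly r 0:]:]:] = (x - [:[:r:]:]) + ([:[:r:]:] - [:[:[:poly r 0:]:]:])"
    by (simp only: diff_add_cancel add_diff_eq)
  also have "\<dots> = y * (beta - 8) + z * gamma + [:[:r':]:] * alpha"
    unfolding yz ra c8 by (simp only: mult.commute)
  also have "\<dots> \<in> J (Suc 0)"
    by (intro J_add J_mult a b c)
  finally show ?case by auto
next
  case (Suc n)
  obtain t y where x: "x = D ^ Suc n * t + gamma * y" "y \<in> K n"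
    using Suc.prems by (rule ideal_power_SucE)
  obtain z k where D: "D ^ Suc n = z + gamma * k" "z \<in> J (Suc (Suc n))" "k \<in> K n"
    using D_power_mem_sum[of "Suc n"] by (auto simp: ideal_sum_def)
  have "t * k + y \<in> K n"
    by (intro ring_ideal_add[OF ring_ideal_power] ring_ideal_mult[OF ring_ideal_power] x D)
  then obtain c where c: "t * k + y - [:[:[:c:]:]:] * gamma ^ n \<in> J (Suc n)"
    using Suc.IH by blast
  have "x - [:[:[:c:]:]:] * gamma ^ Suc n = t * z + gamma * (t * k + y - [:[:[:c:]:]:] * gamma ^ n)"
    unfolding x(1) D(1) by (simp only: power_Suc algebra_simps)
  also have "\<dots> \<in> J (Suc (Suc n))"
    by (intro J_add J_mult[OF D(2)] gamma_mult_J c)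
  finally show ?case by blast
qed

lemma D_power_mem_J_even:
  assumes "even g" "g > 0"
  shows "D ^ (g - 1) \<in> J g"
proof -
  obtain n where n: "g = Suc n" "odd n"
    using assms by (cases g) auto
  have f: "ring_hom (\<lambda>x. [:[:[:x:]:]:] :: R)"
    by (simp add: ring_hom_def one_pCons)
  define h where "h = subst (\<lambda>x. [:[:[:x:]:]:]) (- alpha) beta (- gamma)"
  have h: "ring_hom h"
    unfolding h_def by (rule ring_hom_subst[OF f])
  have gens: "h alpha = - alpha" "h beta = beta" "h gamma = - gamma"
    unfolding h_def by (rule subst_generators[OF f])+
  obtain c where c: "D ^ n - [:[:[:c:]:]:] * gamma ^ n \<in> J (Suc n)"
    using K_power_mem[OF power_mem_ideal_power] by blast
  have "h [:[:[:c:]:]:] = [:[:[:c:]:]:]"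
    by (simp add: h_def subst_def map_poly_pCons)
  \<comment> \<open>The reflection fixes \<open>D\<close> and negates \<open>gamma ^ n\<close>, as
    \<open>n\<close> is odd; the sum of the two relations is free of \<open>c\<close>.\<close>
  then have "h (D ^ n - [:[:[:c:]:]:] * gamma ^ n) = D ^ n + [:[:[:c:]:]:] * gamma ^ n"
    using n(2) by (simp add: ring_hom_simps(4)[OF h] ring_hom_diff[OF h] ring_hom_power[OF h]
        ring_hom_numeral[OF h] gens del: mult_pCons_left)
  then have "D ^ n + [:[:[:c:]:]:] * gamma ^ n \<in> J (Suc n)"
    using J_reflection[OF c] by (simp add: h_def)
  from J_add[OF c this] have "of_nat 2 * D ^ n \<in> J (Suc n)"
    by simp
  then have "D ^ n \<in> J (Suc n)"
    by (rule ideal_cancel_of_nat[OF ring_ideal_J]) simp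
  then show ?thesis by (simp add: n)
qed

subsection \<open>Moment functionals of three-term recurrences\<close>

text \<open>The linear functional on polynomials with moment sequence \<open>v\<close>.\<close>

definition pair :: "(nat \<Rightarrow> 'a::comm_ring_1) \<Rightarrow> 'a poly \<Rightarrow> 'a" where
  "pair v p = (\<Sum>i\<le>degree p. coeff p i * v i)"

lemma pair_eq:
  assumes "degree p \<le> n"
  shows "pair v p = (\<Sum>i\<le>n. coeff p i * v i)"
  unfolding pair_def using assms by (intro sum.mono_neutral_left) (auto simp: coeff_eq_0)

lemma pair_add: "pair v (p + q) = pair v p + pair v q"
proof -
  let ?n = "max (degree p) (degree q)"
  show ?thesis
    using pair_eq[of "p + q" ?n v] pair_eq[of p ?n v] pair_eq[of q ?n v]
    by (simp add: degree_add_le sum.distrib distrib_right)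
qed

lemma pair_smult: "pair v (smult c p) = c * pair v p"
  using pair_eq[OF degree_smult_le, of v c p] by (simp add: pair_def sum_distrib_left mult.assoc)

lemma pair_0 [simp]: "pair v 0 = 0"
  by (simp add: pair_def)

lemma pair_pCons: "pair v (pCons c p) = c * v 0 + pair (\<lambda>n. v (Suc n)) p"
proof -
  have "pair v (pCons c p) = (\<Sum>i\<le>Suc (degree p). coeff (pCons c p) i * v i)"
    by (rule pair_eq) (rule degree_pCons_le)
  then show ?thesis
    by (simp only: sum.atMost_Suc_shift) (simp add: pair_def)
qed

lemma pair_fun_add: "pair (\<lambda>n. v n + w n) p = pair v p + pair w p"
  by (simp add: pair_def sum.distrib distrib_left)

lemma pair_fun_mult: "pair (\<lambda>n. c * v n) p = c * pair v p"
  by (simp add: pair_def sum_distrib_left mult.left_commute)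

context
  fixes A B :: "nat \<Rightarrow> real"
  assumes A: "\<And>m. A m > 0" and B: "\<And>m. B (Suc m) > 0"
begin

text \<open>\<open>jacobi n j\<close> is the coefficient of \<open>q\<^sub>j\<close> in the expansion of \<open>x^n\<close>, where
  \<open>x q\<^sub>m = A\<^sub>m q\<^bsub>m+1\<^esub> + B\<^sub>m q\<^bsub>m-1\<^esub>\<close>.\<close>

fun jacobi :: "nat \<Rightarrow> nat \<Rightarrow> real" where
  "jacobi 0 j = (if j = 0 then 1 else 0)"
| "jacobi (Suc n) 0 = B 1 * jacobi n 1"
| "jacobi (Suc n) (Suc j) = A j * jacobi n j + B (Suc (Suc j)) * jacobi n (Suc (Suc j))"

lemma jacobi_nonneg: "jacobi n j \<ge> 0"
  using A B by (induction n j rule: jacobi.induct) (simp_all add: less_imp_le)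

text \<open>\<open>jacobi n j\<close> is a weighted count of paths of \<open>n\<close> steps up or
  down by one from 0 to \<open>j\<close> that stay nonnegative. All weights are positive, and such a
  path exists.\<close>

lemma jacobi_pos: "j \<le> n \<Longrightarrow> even (n + j) \<Longrightarrow> jacobi n j > 0"
proof (induction n j rule: jacobi.induct)
  case (2 n)
  then have "n \<noteq> 0" by (cases n) auto
  then show ?case using 2 B[of 0] by simp
next
  case (3 n j)
  then show ?case
    using A[of j] B[of "Suc j"] jacobi_nonneg[of n "Suc (Suc j)"]
    by (simp add: add_pos_nonneg less_imp_le)
qed auto

text \<open>This functional reads off the coefficient of \<open>q j\<close> in the expansion in the
  polynomials \<open>q\<close>; \<open>moment 0\<close> is the one that makes them
  orthogonal.\<close>

definition moment :: "nat \<Rightarrow> complex poly \<Rightarrow> complex" where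
  "moment j = pair (\<lambda>n. of_real (jacobi n j))"

lemma moment_pCons_0:
  "moment 0 (pCons c p) = c + of_real (B 1) * moment 1 p"
  "moment (Suc j) (pCons c p) = of_real (A j) * moment j p + of_real (B (Suc (Suc j))) * moment (Suc (Suc j)) p"
  by (simp_all add: moment_def pair_pCons pair_fun_add pair_fun_mult)

context
  fixes q :: "nat \<Rightarrow> complex poly"
  assumes q0: "q 0 = 1" and q1: "[:0, 1:] * q 0 = smult (of_real (A 0)) (q 1)"
    and q_rec: "\<And>m. [:0, 1:] * q (Suc m) = smult (of_real (A (Suc m))) (q (Suc (Suc m))) + smult (of_real (B (Suc m))) (q m)"
begin

text \<open>Multiplication by x acts on the moments by the same coefficients as in the recurrence of
  \<open>q\<close>, so duality passes from two consecutive indices to the next.\<close>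

lemma moment_q: "moment j (q m) = (if j = m then 1 else 0)"
proof (induction m arbitrary: j rule: less_induct)
  case (less m)
  consider "m = 0" | "m = 1" | i where "m = Suc (Suc i)"
    by (metis One_nat_def not0_implies_Suc)
  then show ?case
  proof cases
    case 1
    then show ?thesis by (simp add: q0 moment_def one_pCons pair_pCons)
  next
    case 2
    have "of_real (A 0) * moment j (q m) = moment j ([:0, 1:] * q 0)"
      unfolding q1 by (simp add: moment_def pair_smult 2)
    also have "\<dots> = (if j = 1 then of_real (A 0) else 0)"
      using less.IH[of 0] 2 by (cases j) (auto simp: moment_pCons_0)
    finally show ?thesis using A[of 0] 2 by (auto split: if_splits)
  next
    case 3
    have "of_real (A (Suc i)) * moment j (q m) =
        moment j ([:0, 1:] * q (Suc i)) - of_real (B (Suc i)) * moment j (q i)"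
      unfolding q_rec by (simp add: moment_def pair_smult pair_add 3)
    also have "\<dots> = (if j = m then of_real (A (Suc i)) else 0)"
      using less.IH[of i] less.IH[of "Suc i"] 3 by (cases j) (auto simp: moment_pCons_0)
    finally show ?thesis using A[of "Suc i"] by (auto split: if_splits)
  qed
qed

text \<open>Each multiplication by x moves the index by at most one, so from \<open>m\<close> the
  index \<open>j\<close> is out of reach in \<open>degree p\<close> steps.\<close>

lemma moment_mult_q:
  assumes "degree p + j < m"
  shows "moment j (p * q m) = 0"
  using assms
proof (induction p arbitrary: j)
  case 0
  then show ?case by (simp add: moment_def)
next
  case (pCons a p)
  have *: "pCons a p * q m = smult a (q m) + pCons 0 (p * q m)"
    by simp
  have "moment j (smult a (q m)) = 0"
    using pCons.prems moment_q[of j m] by (simp add: moment_def pair_smult)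
  moreover have "moment j (pCons 0 (p * q m)) = 0"
  proof (cases "p = 0")
    case True
    then show ?thesis by (simp add: moment_def)
  next
    case False
    then have "degree p + Suc j < m"
      using pCons.prems by simp
    then show ?thesis
      using pCons.IH by (cases j) (auto simp: moment_pCons_0)
  qed
  ultimately show ?case
    unfolding * by (simp add: moment_def pair_add)
qed

lemma moment_monom_pos: "moment 0 (monom 1 (2 * h)) \<noteq> 0"
proof -
  have "moment 0 (monom 1 (2 * h)) = of_real (jacobi (2 * h) 0)"
    by (simp add: moment_def pair_def degree_monom_eq sum.delta if_distrib[of "\<lambda>x. x * _"] cong: if_cong)
  then show ?thesis
    using jacobi_pos[of 0 "2 * h"] by simp
qed

text \<open>\<open>moment 0\<close> annihilates both products by degree, while on the monomial it is
  the positive number \<open>jacobi (2 * h) 0\<close>.\<close>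

lemma monom_not_combination:
  assumes "degree P < h" "degree Q < h"
  shows "P * q (Suc h) + Q * q h \<noteq> monom 1 (2 * h)"
proof
  assume "P * q (Suc h) + Q * q h = monom 1 (2 * h)"
  then have "moment 0 (monom 1 (2 * h)) = moment 0 (P * q (Suc h)) + moment 0 (Q * q h)"
    by (metis moment_def pair_add)
  also have "\<dots> = 0"
    using assms by (simp add: moment_mult_q)
  finally show False by (simp add: moment_monom_pos)
qed

lemma degree_q: "degree (q m) = m"
proof (induction m rule: less_induct)
  case (less m)
  consider "m = 0" | "m = 1" | i where "m = Suc (Suc i)"
    by (metis One_nat_def not0_implies_Suc)
  then show ?case
  proof cases
    case 2
    have "degree (smult (of_real (A 0)) (q 1)) = 1"
      unfolding q1[symmetric] by (simp add: q0 one_pCons)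
    then show ?thesis using A[of 0] 2 by simp
  next
    case 3
    have nz: "q (Suc i) \<noteq> 0"
      using less.IH[of "Suc i"] 3 by auto
    have "smult (of_real (A (Suc i))) (q m) = [:0, 1:] * q (Suc i) - smult (of_real (B (Suc i))) (q i)"
      unfolding q_rec by (simp add: 3)
    moreover have "degree ([:0, 1:] * q (Suc i) - smult (of_real (B (Suc i))) (q i)) = m"
    proof -
      have "degree ([:0, 1:] * q (Suc i)) = m"
        using less.IH[of "Suc i"] 3 nz by (simp add: degree_pCons_eq)
      moreover have "degree (smult (of_real (B (Suc i))) (q i)) < m"
        using less.IH[of i] 3 degree_smult_le[of _ "q i"] by (metis le_imp_less_Suc less_SucI lessI)
      ultimately show ?thesis
        using degree_add_eq_left[of "- smult (of_real (B (Suc i))) (q i)" "[:0, 1:] * q (Suc i)"] by simp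
    qed
    ultimately have "degree (smult (of_real (A (Suc i))) (q m)) = m" by simp
    then show ?thesis using A[of "Suc i"] by simp
  qed (simp add: q0)
qed

text \<open>Since the coefficients \<open>B (Suc m)\<close> are nonzero, a common divisor descends
  along the recurrence to \<open>q 0 = 1\<close>.\<close>

lemma coprime_q: "coprime (q (Suc m)) (q m)"
proof (induction m)
  case (Suc m)
  show ?case
  proof (rule coprimeI)
    fix d assume d: "d dvd q (Suc (Suc m))" "d dvd q (Suc m)"
    have "smult (of_real (B (Suc m))) (q m) = [:0, 1:] * q (Suc m) - smult (of_real (A (Suc m))) (q (Suc (Suc m)))"
      unfolding q_rec by simp
    moreover have "d dvd [:0, 1:] * q (Suc m) - smult (of_real (A (Suc m))) (q (Suc (Suc m)))"
      using d by (intro dvd_diff dvd_mult dvd_smult)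
    ultimately have "d dvd smult (of_real (B (Suc m))) (q m)"
      by simp
    then have "d dvd q m"
      using B[of m] by (simp add: dvd_smult_iff)
    then show "is_unit d"
      using Suc d(2) by (meson coprime_common_divisor)
  qed
qed (simp add: q0)

text \<open>Coprimality makes \<open>q h\<close> divide \<open>P\<close>, whose degree is too
  small.\<close>

lemma no_low_syzygy:
  assumes "P * q (Suc h) + Q * q h = 0" "degree P < h"
  shows "P = 0 \<and> Q = 0"
proof -
  have nz: "q h \<noteq> 0"
    using assms(2) degree_q[of h] by auto
  have "P * q (Suc h) = q h * (- Q)"
    using assms(1) by (simp add: eq_neg_iff_add_eq_0 mult.commute)
  then have "q h dvd P * q (Suc h)" by simp
  then have "q h dvd P"
    using coprime_q[of h] by (simp add: coprime_dvd_mult_left_iff coprime_commute)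
  then have "P = 0"
    using assms(2) degree_q[of h] dvd_imp_degree_le by (metis not_le)
  then show ?thesis using assms(1) nz by simp
qed

end

end

subsection \<open>The lower bound\<close>

text \<open>The ring C[x][t] with outer variable t: \<open>coeff p n\<close> is the coefficient of
  t^n, a polynomial in x.\<close>

type_synonym S = "complex poly poly"

definition t_var :: S where "t_var = [:0, 1:]"

definition x_var :: S where "x_var = [:[:0, 1:]:]"

text \<open>In terms of \<open>\<epsilon> = t x\<close> and \<open>\<gamma> = t\<close>, this is the span of the monomials in \<open>\<epsilon>\<close> and \<open>\<gamma>\<close>.\<close>

definition graded :: "S set" where
  "graded = {p. \<forall>n. degree (coeff p n) \<le> n}"

lemma t_power_eq: "t_var ^ n = monom 1 n"
  by (simp add: t_var_def monom_altdef)

lemma coeff_t_power_mult: "coeff (t_var ^ n * p) k = (if k < n then 0 else coeff p (k - n))"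
  by (simp add: t_power_eq coeff_monom_mult)

lemma coeff_t_mult_Suc: "coeff (t_var * p) (Suc k) = coeff p k"
  using coeff_t_power_mult[of 1 p "Suc k"] by simp

lemma t_dvd_iff: "t_var dvd p \<longleftrightarrow> coeff p 0 = 0"
  using poly_eq_0_iff_dvd[of p 0] by (simp add: t_var_def poly_0_coeff_0)

lemma coeff_eq_0_of_dvd: "t_var ^ n dvd p \<Longrightarrow> k < n \<Longrightarrow> coeff p k = 0"
  by (auto simp: dvd_def coeff_t_power_mult)

lemma t_power_dvd_cancel:
  assumes "coeff u 0 \<noteq> 0" "t_var ^ k dvd u * p"
  shows "t_var ^ k dvd p"
  using assms(2)
proof (induction k)
  case (Suc k)
  then have "t_var ^ k dvd p"
    by (meson dvd_trans le_imp_power_dvd le_SucI order_refl)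
  then obtain y where y: "p = t_var ^ k * y" by (auto simp: dvd_def)
  have "t_var ^ k * t_var dvd t_var ^ k * (u * y)"
    using Suc.prems by (simp add: y ac_simps)
  then have "t_var dvd u * y"
    by (subst (asm) dvd_mult_cancel_left) (auto simp: t_var_def)
  then have "coeff y 0 = 0"
    using assms(1) by (simp add: t_dvd_iff coeff_mult)
  then have "t_var dvd y"
    by (simp add: t_dvd_iff)
  then show ?case
    by (simp add: y mult.commute mult_dvd_mono)
qed simp

lemma graded_add: "p \<in> graded \<Longrightarrow> q \<in> graded \<Longrightarrow> p + q \<in> graded"
  by (simp add: graded_def degree_add_le)

lemma graded_mult: "p \<in> graded \<Longrightarrow> q \<in> graded \<Longrightarrow> p * q \<in> graded"
  unfolding graded_def mem_Collect_eq coeff_mult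
proof (intro allI degree_sum_le)
  fix n i :: nat assume pq: "\<forall>n. degree (coeff p n) \<le> n" "\<forall>n. degree (coeff q n) \<le> n" and "i \<in> {..n}"
  have "degree (coeff p i * coeff q (n - i)) \<le> degree (coeff p i) + degree (coeff q (n - i))"
    by (rule degree_mult_le)
  also have "\<dots> \<le> i + (n - i)"
    using pq by (intro add_mono) auto
  finally show "degree (coeff p i * coeff q (n - i)) \<le> n"
    using \<open>i \<in> {..n}\<close> by simp
qed simp

lemma graded_const: "[:[:c:]:] \<in> graded"
  by (auto simp: graded_def coeff_pCons split: nat.split)

lemma graded_of_nat: "of_nat n \<in> graded"
  using graded_const[of "of_nat n"] by (simp add: of_nat_poly)

lemma graded_uminus: "p \<in> graded \<Longrightarrow> - p \<in> graded"
  by (simp add: graded_def)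

lemma graded_numeral: "numeral k \<in> graded"
  using graded_of_nat[of "numeral k"] by simp

lemma graded_power: "p \<in> graded \<Longrightarrow> p ^ n \<in> graded"
  using graded_of_nat[of 1] by (induction n) (auto intro: graded_mult)

lemma graded_t: "t_var \<in> graded" and graded_tx: "t_var * x_var \<in> graded"
  by (auto simp: graded_def t_var_def x_var_def coeff_pCons split: nat.split)

lemma graded_1: "1 \<in> graded"
  using graded_of_nat[of 1] by simp

lemmas graded_intros = graded_1 graded_add graded_mult graded_const graded_of_nat graded_uminus
  graded_numeral graded_power graded_t graded_tx

lemma graded_zrec:
  assumes "a \<in> graded" "b \<in> graded" "c \<in> graded"
  shows "zrec a b c k \<in> graded"
  using assms
proof (induction a b c k rule: zrec.induct)
  case (1 a b c)
  then show ?case using graded_of_nat[of 0] by simp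
next
  case (2 a b c)
  then show ?case using graded_of_nat[of 1] by simp
next
  case (3 a b c k)
  then show ?case
    unfolding zrec.simps(3) by (intro graded_intros) auto
qed

lemma graded_poly_map_poly:
  assumes "f 0 = 0" "\<And>y. f y \<in> graded" "a \<in> graded"
  shows "poly (map_poly f p) a \<in> graded"
proof (induction p)
  case 0
  then show ?case using graded_of_nat[of 0] by simp
next
  case (pCons c p)
  then show ?case using assms by (auto simp: map_poly_pCons intro!: graded_intros)
qed

lemma graded_subst:
  assumes "a \<in> graded" "b \<in> graded" "c \<in> graded"
  shows "subst (\<lambda>y. [:[:y:]:]) a b c p \<in> graded"
  unfolding subst_def by (intro graded_poly_map_poly graded_const assms) simp_all

section \<open>The specialised sequence and its approximate roots\<close>

abbreviation zs :: "S \<Rightarrow> nat \<Rightarrow> S" where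
  "zs a \<equiv> zrec a (8 + t_var * x_var) t_var"

text \<open>At t = 0 each term is \<open>i ^ 2 * (8 + (- 1) ^ i * 8)\<close> times the term two
  places earlier. The even chain starts at 0, and the odd chain stops after the initial 1 because
  the factor at \<open>i = 1\<close> is zero.\<close>

lemma t_dvd_zs:
  assumes "t_var dvd a" "k \<noteq> 1"
  shows "t_var dvd zs a k"
  using assms(2)
proof (induction k rule: less_induct)
  case (less k)
  consider "k = 0" | i where "k = Suc (Suc i)"
    using less.prems by (metis One_nat_def not0_implies_Suc)
  then show ?case
  proof cases
    case 2
    have "t_var dvd (8 + t_var * x_var + (- 1) ^ i * 8) * zs a i"
    proof (cases "i = 1")
      case False
      then show ?thesis using less.IH[of i] 2 by simp
    qed simp
    then show ?thesis
      unfolding 2 zrec.simps using assms(1) by (intro dvd_add) (auto simp: mult.assoc)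
  qed simp
qed

text \<open>The derivative of \<open>zs a k\<close> in \<open>a\<close> at \<open>a = 0\<close>, modulo \<open>t\<close>; it is nonzero at even \<open>k > 0\<close>, where Newton
  iteration in \<open>t\<close> therefore finds roots.\<close>

fun zs_slope :: "nat \<Rightarrow> nat" where
  "zs_slope 0 = 0"
| "zs_slope (Suc 0) = 0"
| "zs_slope (Suc (Suc k)) = (if k = 0 then 1 else if even k then 16 * k ^ 2 * zs_slope k else 0)"

lemma zs_slope_pos: "zs_slope (Suc (Suc (2 * m))) > 0"
  by (induction m) simp_all

text \<open>First-order Taylor expansion in \<open>a\<close>, obtained by differencing the
  recursion; all other contributions carry \<open>d\<close> together with an extra factor t.\<close>

lemma zs_add:
  assumes "t_var dvd a" "t_var dvd d"
  shows "t_var * d dvd zs (a + d) k - zs a k - of_nat (zs_slope k) * d"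
proof (induction k rule: less_induct)
  case (less k)
  consider "k = 0" | "k = 1" | i where "k = Suc (Suc i)"
    by (metis One_nat_def not0_implies_Suc)
  then show ?case
  proof cases
    case 3
    let ?y = "\<lambda>k. zs (a + d) k - zs a k"
    have d_dvd: "d dvd ?y j" if "j < k" for j
    proof -
      have "d dvd ?y j - of_nat (zs_slope j) * d"
        using less.IH[OF that] dvd_mult_right by blast
      then show ?thesis
        using dvd_diff_left_iff[of d "of_nat (zs_slope j) * d"] by simp
    qed
    have 1: "t_var * d dvd a * ?y (Suc i)"
      using assms(1) d_dvd 3 by (intro mult_dvd_mono) auto
    \<comment> \<open>The term \<open>zs (a + d) (Suc i)\<close> is divisible by t except at
      \<open>i = 0\<close>, where it equals 1.\<close>
    have 2: "t_var * d dvd zs (a + d) (Suc i) * d - of_nat (if i = 0 then 1 else 0) * d"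
    proof (cases "i = 0")
      case False
      then show ?thesis
        using t_dvd_zs[of "a + d" "Suc i"] assms by (simp add: mult_dvd_mono del: zrec.simps)
    qed simp
    \<comment> \<open>Modulo t the leading factor is 16 for even \<open>i\<close> and 0 for odd
      \<open>i\<close>.\<close>
    have 3: "t_var * d dvd (8 + t_var * x_var + (- 1) ^ i * 8) * ?y i - of_nat (if even i then 16 * zs_slope i else 0) * d"
    proof (cases "even i")
      case True
      have "t_var * d dvd 16 * (?y i - of_nat (zs_slope i) * d) + t_var * ?y i * x_var"
        using less.IH[of i] d_dvd[of i] 3 by (intro dvd_add dvd_mult dvd_mult2 mult_dvd_mono) auto
      then show ?thesis using True by (simp add: algebra_simps del: zrec.simps)
    next
      case False
      have "t_var * d dvd t_var * ?y i * x_var"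
        using d_dvd[of i] 3 by (intro dvd_mult2 mult_dvd_mono) auto
      then show ?thesis using False by (simp add: algebra_simps del: zrec.simps)
    qed
    have 4: "t_var * d dvd t_var * ?y (i - 1)"
      using d_dvd[of "i - 1"] \<open>k = Suc (Suc i)\<close> by (intro mult_dvd_mono) auto
    have slope: "zs_slope k = (if i = 0 then 1 else 0) + i ^ 2 * (if even i then 16 * zs_slope i else 0)"
      using \<open>k = Suc (Suc i)\<close> by simp
    have expand: "(a + d) * y1 + p * b * y2 + q * t_var * y3 - (a * z1 + p * b * z2 + q * t_var * z3) - (l + p * m) * d =
        a * (y1 - z1) + (y1 * d - l * d) + p * (b * (y2 - z2) - m * d) + q * (t_var * (y3 - z3))"
      for y1 y2 y3 z1 z2 z3 p q b l m :: S
      by (simp add: algebra_simps)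
    have "zs (a + d) k - zs a k - of_nat (zs_slope k) * d =
        a * ?y (Suc i) + (zs (a + d) (Suc i) * d - of_nat (if i = 0 then 1 else 0) * d)
        + of_nat (i ^ 2) * ((8 + t_var * x_var + (- 1) ^ i * 8) * ?y i - of_nat (if even i then 16 * zs_slope i else 0) * d)
        + of_nat (2 * i * (i - 1)) * (t_var * ?y (i - 1))"
      unfolding slope unfolding \<open>k = Suc (Suc i)\<close> zrec.simps(3) of_nat_add of_nat_mult[of "i ^ 2" "if _ then _ else _"]
      by (rule expand)
    then show ?thesis
      using 1 2 3 4 by (simp only: dvd_add dvd_mult)
  qed simp_all
qed

lemma zs_root:
  "\<exists>a\<in>graded. t_var dvd a \<and> t_var ^ Suc n dvd zs a (2 * Suc h)"
proof (induction n)
  case 0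
  have "t_var ^ Suc 0 dvd zs 0 (2 * Suc h)"
    using t_dvd_zs[of 0 "2 * Suc h"] by simp
  then show ?case using graded_of_nat[of 0] by auto
next
  case (Suc n)
  then obtain a where a: "a \<in> graded" "t_var dvd a" "t_var ^ Suc n dvd zs a (2 * Suc h)" by blast
  let ?k = "2 * Suc h"
  define u where "u = (of_nat (zs_slope ?k) :: complex)"
  have u: "u \<noteq> 0" unfolding u_def using zs_slope_pos[of h] by simp
  \<comment> \<open>The Newton correction cancels the linear term, and the remaining error is
    divisible by \<open>t_var * d\<close>, so the order grows by one. Dividing by a constant slope
    keeps the root in \<open>graded\<close>.\<close>
  define d where "d = [:[:- 1 / u:]:] * zs a ?k"
  have d_dvd: "t_var ^ Suc n dvd d"
    unfolding d_def using a(3) by (rule dvd_mult)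
  then have sd: "t_var dvd d"
    by (meson dvd_trans dvd_power zero_less_Suc)
  have "of_nat (zs_slope ?k) * d = - zs a ?k"
  proof -
    have "of_nat (zs_slope ?k) = ([:[:u:]:] :: S)"
      by (simp add: u_def of_nat_poly)
    moreover have "[:[:u:]:] * [:[:- 1 / u:]:] = (- 1 :: S)"
      using u by (simp add: one_pCons)
    ultimately have "of_nat (zs_slope ?k) * d = - 1 * zs a ?k"
      unfolding d_def by (metis mult.assoc)
    then show ?thesis by (simp del: zrec.simps zs_slope.simps)
  qed
  then have "t_var * d dvd zs (a + d) ?k"
    using zs_add[OF a(2) sd, of ?k] by (simp del: zrec.simps zs_slope.simps)
  moreover have "t_var ^ Suc (Suc n) dvd t_var * d"
    using d_dvd by (simp add: mult_dvd_mono)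
  ultimately have "t_var ^ Suc (Suc n) dvd zs (a + d) ?k"
    by (rule dvd_trans[rotated])
  moreover have "8 + t_var * x_var \<in> graded"
    by (intro graded_intros)
  then have "a + d \<in> graded"
    unfolding d_def by (intro graded_intros graded_zrec a(1))
  moreover have "t_var dvd a + d"
    using a(2) sd by (rule dvd_add)
  ultimately show ?case by blast
qed

section \<open>Leading coefficients at an approximate root as orthogonal polynomials\<close>

fun lead_q :: "nat \<Rightarrow> complex poly" where
  "lead_q 0 = 1"
| "lead_q (Suc 0) = [:0, 1:]"
| "lead_q (Suc (Suc m)) = smult (of_nat ((2 * m + 3) ^ 2)) ([:0, 1:] * lead_q (Suc m))
     - smult (of_nat ((2 * m + 3) * (2 * m + 1)) / 4) (lead_q m)"

text \<open>\<open>jac_A\<close> and \<open>jac_B\<close> are the coefficients obtained when the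
  recurrence of \<open>lead_q\<close> is solved for x times \<open>lead_q (Suc m)\<close>.\<close>

definition jac_A :: "nat \<Rightarrow> real" where
  "jac_A m = 1 / real ((2 * m + 1) ^ 2)"

definition jac_B :: "nat \<Rightarrow> real" where
  "jac_B m = (2 * real m - 1) / (4 * (2 * real m + 1))"

lemma jac_A_pos: "jac_A m > 0"
  by (simp add: jac_A_def)

lemma jac_B_pos: "jac_B (Suc m) > 0"
  by (simp add: jac_B_def)

lemma lead_q_1: "[:0, 1:] * lead_q 0 = smult (of_real (jac_A 0)) (lead_q 1)"
  by (simp add: jac_A_def)

lemma lead_q_rec: "[:0, 1:] * lead_q (Suc m) =
    smult (of_real (jac_A (Suc m))) (lead_q (Suc (Suc m))) + smult (of_real (jac_B (Suc m))) (lead_q m)"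
proof -
  define r where "r = (of_nat (2 * m + 3) :: complex)"
  have r: "r \<noteq> 0"
    unfolding r_def by (simp only: of_nat_eq_0_iff)
  have A: "of_real (jac_A (Suc m)) = 1 / r ^ 2"
    by (simp add: jac_A_def r_def add.commute)
  have B: "of_real (jac_B (Suc m)) = of_nat (2 * m + 1) / (4 * r)"
    by (simp add: jac_B_def r_def add.commute)
  have C: "of_nat ((2 * m + 3) ^ 2) = r ^ 2" "of_nat ((2 * m + 3) * (2 * m + 1)) = r * of_nat (2 * m + 1)"
    by (simp_all only: r_def of_nat_power of_nat_mult)
  have "1 / r ^ 2 * (r * of_nat (2 * m + 1) / 4) = of_nat (2 * m + 1) / (4 * r)"
    using r by (simp only: power2_eq_square) (simp add: field_simps)
  then show ?thesis
    unfolding lead_q.simps A B C using r by (simp only: smult_diff_right smult_smult) simp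
qed

lemmas lead_q_facts = jac_A_pos jac_B_pos lead_q.simps(1) lead_q_1 lead_q_rec

lemma coeff_mult_low:
  assumes "\<forall>k<i. coeff p k = 0"
  shows "coeff (p * u) i = coeff p i * coeff u 0"
proof -
  have "coeff (p * u) i = (\<Sum>k\<in>{i}. coeff p k * coeff u (i - k))"
    unfolding coeff_mult using assms by (intro sum.mono_neutral_right) auto
  then show ?thesis by simp
qed

lemma zs_order:
  assumes a: "t_var dvd a" "t_var ^ N dvd zs a (2 * M)" and m: "m \<le> M" "m \<le> N"
  shows "t_var ^ m dvd zs a (Suc (2 * m)) \<and> t_var ^ m dvd zs a (2 * m)"
proof -
  \<comment> \<open>Orders are capped at \<open>N\<close> because \<open>a\<close> is a root only up
    to t^N; with the cap, \<open>w M\<close> lies in every \<open>L n\<close>.\<close>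
  define L where "L n = {p :: S. t_var ^ min n N dvd p}" for n
  define e where "e m = zs a (Suc (2 * m))" for m
  define w where "w m = zs a (2 * m)" for m
  have "e m \<in> L m \<and> w m \<in> L m"
  proof (rule order_of_recursion[where eps = "t_var * x_var" and c = t_var and a = a and M = M
        and p = "\<lambda>m. of_nat ((2 * m + 1) ^ 2)" and d = "\<lambda>m. of_nat (2 * (2 * m + 1) * (2 * m))"
        and q = "\<lambda>m. of_nat ((2 * m + 2) ^ 2) * (16 + t_var * x_var)"
        and f = "\<lambda>m. of_nat (2 * (2 * m + 2) * (2 * m + 1))"])
    show "ring_ideal (L n)" for n
      unfolding ring_ideal_def L_def by (simp add: dvd_add dvd_mult)
    show "L 0 = UNIV"
      by (simp add: L_def)
    have t_var_L: "t_var * p \<in> L (Suc n)" if "p \<in> L n" for n p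
    proof -
      have "t_var ^ min (Suc n) N dvd t_var ^ Suc (min n N)"
        by (rule le_imp_power_dvd) simp
      also have "\<dots> dvd t_var * p"
        using that by (simp add: L_def mult_dvd_mono)
      finally show ?thesis by (simp add: L_def)
    qed
    then show "t_var * p \<in> L (Suc n)" if "p \<in> L n" for n p using that .
    show "t_var * x_var * p \<in> L (Suc n)" if "p \<in> L n" for n p
      using t_var_L[of "x_var * p" n] that by (simp add: L_def mult.assoc dvd_mult)
    show "e (Suc k) = a * w (Suc k) + of_nat ((2 * k + 1) ^ 2) * (t_var * x_var) * e k
        + of_nat (2 * (2 * k + 1) * (2 * k)) * t_var * w k" for k
      using zrec.simps(3)[of a "8 + t_var * x_var" t_var "Suc (2 * k)"]
      by (simp add: e_def w_def del: zrec.simps)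
    show "w (Suc (Suc k)) = a * e (Suc k) + of_nat ((2 * k + 2) ^ 2) * (16 + t_var * x_var) * w (Suc k)
        + of_nat (2 * (2 * k + 2) * (2 * k + 1)) * t_var * e k" for k
      using zrec.simps(3)[of a "8 + t_var * x_var" t_var "Suc (Suc (2 * k))"]
      by (simp add: e_def w_def del: zrec.simps)
    show "p \<in> L n" if "(a ^ 2 + of_nat ((2 * k + 2) ^ 2) * (16 + t_var * x_var)) * p \<in> L n" for k n p
    proof -
      \<comment> \<open>At t = 0 the factor to be cancelled is the nonzero constant
        \<open>16 * (2 * k + 2) ^ 2\<close>.\<close>
      have "coeff a 0 = 0"
        using a(1) by (simp add: t_dvd_iff)
      moreover have "(of_nat ((2 * k + 2) ^ 2) :: complex poly) \<noteq> 0"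
        by (simp only: of_nat_eq_0_iff) simp
      ultimately have "coeff (a ^ 2 + of_nat ((2 * k + 2) ^ 2) * (16 + t_var * x_var)) 0 \<noteq> 0"
        by (simp add: power2_eq_square coeff_mult t_var_def of_nat_poly numeral_poly del: of_nat_power of_nat_add of_nat_Suc)
      then show ?thesis
        using that unfolding L_def mem_Collect_eq by (rule t_power_dvd_cancel)
    qed
    show "w M \<in> L n" for n
      unfolding L_def w_def mem_Collect_eq
      by (rule dvd_trans[OF le_imp_power_dvd[OF min.cobounded2] a(2)])
  qed (use m in simp_all)
  then show ?thesis
    using m by (simp add: L_def e_def w_def min_absorb1 del: zrec.simps)
qed

text \<open>Compare lowest-order coefficients in t: terms with a factor \<open>a\<close> drop out,
  and eliminating the leading coefficient of \<open>w\<close> leaves the recurrence of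
  \<open>lead_q\<close>.\<close>

lemma zs_lead:
  assumes a: "t_var dvd a" "t_var ^ N dvd zs a (2 * M)" and MN: "M \<le> N"
  shows "m \<le> M \<Longrightarrow> coeff (zs a (Suc (2 * m))) m = lead_q m"
proof (induction m rule: less_induct)
  case (less m)
  define e where "e m = zs a (Suc (2 * m))" for m
  define w where "w m = zs a (2 * m)" for m
  have ord: "t_var ^ k dvd e k" "t_var ^ k dvd w k" if "k \<le> M" for k
    using zs_order[OF a, of k] that MN by (simp_all add: e_def w_def del: zrec.simps)
  have a_mult: "coeff (a * p) k = 0" if "t_var ^ k dvd p" for p k
    using mult_dvd_mono[OF a(1) that] coeff_eq_0_of_dvd[of "Suc k" "a * p" k] by simp
  have e_rec: "e (Suc k) = a * w (Suc k) + of_nat ((2 * k + 1) ^ 2) * (t_var * (x_var * e k))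
      + of_nat (2 * (2 * k + 1) * (2 * k)) * (t_var * w k)" for k
    using zrec.simps(3)[of a "8 + t_var * x_var" t_var "Suc (2 * k)"]
    by (simp add: e_def w_def mult.assoc del: zrec.simps)
  have w_rec: "w (Suc (Suc k)) = a * e (Suc k) + of_nat ((2 * k + 2) ^ 2) * (16 * w (Suc k) + t_var * (x_var * w (Suc k)))
      + of_nat (2 * (2 * k + 2) * (2 * k + 1)) * (t_var * e k)" for k
    using zrec.simps(3)[of a "8 + t_var * x_var" t_var "Suc (Suc (2 * k))"]
    by (simp add: e_def w_def algebra_simps del: zrec.simps)
  have of_nat_coeff: "coeff (of_nat n * p) k = of_nat n * coeff p k" for n k and p :: S
    by (simp add: of_nat_poly)
  have x_var_coeff: "coeff (x_var * p) k = [:0, 1:] * coeff p k" for p k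
    by (simp add: x_var_def)
  have e_lead: "coeff (e (Suc k)) (Suc k) = of_nat ((2 * k + 1) ^ 2) * ([:0, 1:] * coeff (e k) k)
      + of_nat (2 * (2 * k + 1) * (2 * k)) * coeff (w k) k" if "Suc k \<le> M" for k
    unfolding e_rec coeff_add of_nat_coeff coeff_t_mult_Suc x_var_coeff
    using a_mult[OF ord(2)[OF that]] by simp
  \<comment> \<open>Since \<open>w (Suc (Suc k))\<close> has order at least \<open>k + 2\<close>,
    its coefficient at t^(k+1) vanishes; this ties the leading coefficient of
    \<open>w (Suc k)\<close> to that of \<open>e k\<close>.\<close>
  have w_lead: "of_nat ((2 * k + 2) ^ 2) * (16 * coeff (w (Suc k)) (Suc k))
      + of_nat (2 * (2 * k + 2) * (2 * k + 1)) * coeff (e k) k = 0" if "Suc (Suc k) \<le> M" for k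
  proof -
    have "coeff (w (Suc (Suc k))) (Suc k) = 0"
      using coeff_eq_0_of_dvd[OF ord(2)[OF that]] by simp
    moreover have "coeff (w (Suc k)) k = 0"
      using coeff_eq_0_of_dvd[OF ord(2)[of "Suc k"]] that by simp
    moreover have "coeff (a * e (Suc k)) (Suc k) = 0"
      using a_mult[OF ord(1)[of "Suc k"]] that by simp
    moreover have "coeff (16 * w (Suc k)) (Suc k) = 16 * coeff (w (Suc k)) (Suc k)"
      using of_nat_coeff[of 16] by simp
    ultimately show ?thesis
      using arg_cong[OF w_rec[of k], of "\<lambda>p. coeff p (Suc k)"]
      unfolding coeff_add of_nat_coeff coeff_t_mult_Suc x_var_coeff by simp
  qed
  consider "m = 0" | "m = 1" | i where "m = Suc (Suc i)"
    by (metis One_nat_def not0_implies_Suc)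
  then have "coeff (e m) m = lead_q m"
  proof cases
    case 1
    then show ?thesis by (simp add: e_def)
  next
    case 2
    then show ?thesis
      using e_lead[of 0] less.prems by (simp add: e_def)
  next
    case 3
    have IH: "coeff (e i) i = lead_q i" "coeff (e (Suc i)) (Suc i) = lead_q (Suc i)"
      using less.IH[of i] less.IH[of "Suc i"] less.prems 3 by (simp_all add: e_def del: zrec.simps)
    define r where "r = (of_nat (i + 1) :: complex)"
    have r: "r \<noteq> 0"
      unfolding r_def by (simp only: of_nat_eq_0_iff)
    define W where "W = coeff (w (Suc i)) (Suc i)"
    have 1: "coeff (e m) m = smult (of_nat ((2 * i + 3) ^ 2)) ([:0, 1:] * lead_q (Suc i))
        + smult (of_nat (2 * i + 3) * (4 * r)) W"
      using e_lead[of "Suc i"] less.prems 3 IH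
      by (simp add: W_def r_def of_nat_poly algebra_simps)
    have "smult (16 * (4 * r ^ 2)) W + smult (4 * r * of_nat (2 * i + 1)) (lead_q i) = 0"
      using w_lead[of i] less.prems 3 IH
      by (simp add: W_def r_def of_nat_poly numeral_poly algebra_simps power2_eq_square)
    then have "smult (1 / (16 * r)) (smult (16 * (4 * r ^ 2)) W + smult (4 * r * of_nat (2 * i + 1)) (lead_q i)) = 0"
      by simp
    moreover have "1 / (16 * r) * (16 * (4 * r ^ 2)) = 4 * r"
      "1 / (16 * r) * (4 * r * of_nat (2 * i + 1)) = of_nat (2 * i + 1) / 4"
      using r by (simp_all add: power2_eq_square field_simps)
    ultimately have "smult (4 * r) W = - smult (of_nat (2 * i + 1) / 4) (lead_q i)"
      by (simp only: smult_add_right smult_smult eq_neg_iff_add_eq_0)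
    then have "smult (of_nat (2 * i + 3)) (smult (4 * r) W) = - smult (of_nat (2 * i + 3) * (of_nat (2 * i + 1) / 4)) (lead_q i)"
      by (simp only: smult_minus_right smult_smult)
    then have "smult (of_nat (2 * i + 3) * (4 * r)) W = - smult (of_nat ((2 * i + 3) * (2 * i + 1)) / 4) (lead_q i)"
      by (simp only: smult_smult of_nat_mult times_divide_eq_right)
    then have "coeff (e m) m = lead_q (Suc (Suc i))"
      unfolding 1 lead_q.simps by (simp only: diff_conv_add_uminus)
    then show ?thesis by (simp only: 3)
  qed
  then show ?case by (simp add: e_def del: zrec.simps)
qed

lemma D_power_notin_J_odd:
  assumes h: "h \<ge> 1"
  shows "D ^ (2 * h) \<notin> J (2 * h + 1)"
proof
  assume "D ^ (2 * h) \<in> J (2 * h + 1)"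
  then obtain A B C where D: "D ^ (2 * h) = A * Z (2 * Suc h) + B * Z (Suc (2 * Suc h)) + C * Z (2 * Suc (Suc h))"
    by (auto simp: in_J_iff eval_nat_numeral simp del: zrec.simps power_Suc)
  \<comment> \<open>The order \<open>2 * h + 1\<close> puts the first generator beyond t^(2h), the
    order of the image of \<open>D ^ (2 * h)\<close>.\<close>
  obtain a where a: "a \<in> graded" "t_var dvd a" "t_var ^ Suc (2 * h) dvd zs a (2 * Suc h)"
    using zs_root by blast
  have f: "ring_hom (\<lambda>y. [:[:y:]:] :: S)"
    by (simp add: ring_hom_def one_pCons)
  define \<theta> where "\<theta> = subst (\<lambda>y. [:[:y:]:]) a (8 + t_var * x_var) t_var"
  have \<theta>: "ring_hom \<theta>"
    unfolding \<theta>_def by (rule ring_hom_subst[OF f])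
  have gens: "\<theta> alpha = a" "\<theta> beta = 8 + t_var * x_var" "\<theta> gamma = t_var"
    unfolding \<theta>_def by (rule subst_generators[OF f])+
  have \<theta>_graded: "\<theta> p \<in> graded" for p
    unfolding \<theta>_def by (intro graded_subst graded_intros a)
  have \<theta>_D: "\<theta> D = t_var * (x_var * (16 + t_var * x_var))"
    unfolding ring_hom_diff[OF \<theta>] ring_hom_power[OF \<theta>] ring_hom_numeral[OF \<theta>] gens
    by (simp add: algebra_simps power2_eq_square)
  have \<theta>_Z: "\<theta> (Z k) = zs a k" for k
    by (simp only: ring_hom_zrec[OF \<theta>] gens)
  define e where "e m = zs a (Suc (2 * m))" for m
  define w where "w m = zs a (2 * m)" for m
  have w_rec: "w (Suc (Suc h)) = a * e (Suc h) + of_nat ((2 * h + 2) ^ 2) * (16 + t_var * x_var) * w (Suc h)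
      + of_nat (2 * (2 * h + 2) * (2 * h + 1)) * (t_var * e h)"
    using zrec.simps(3)[of a "8 + t_var * x_var" t_var "Suc (Suc (2 * h))"]
    by (simp add: e_def w_def mult.assoc del: zrec.simps)
  \<comment> \<open>\<open>w_rec\<close> rewrites the third generator: \<open>P\<close> and
    \<open>Q\<close> collect the coefficients of \<open>e (Suc h)\<close> and of
    \<open>t_var * e h\<close>, both of order at least \<open>h + 1\<close>. All multiples of
    \<open>w (Suc h)\<close> go into \<open>t\<close>.\<close>
  define P where "P = \<theta> B + \<theta> C * a"
  define Q where "Q = \<theta> C * of_nat (2 * (2 * h + 2) * (2 * h + 1))"
  have PQ: "P \<in> graded" "Q \<in> graded"
    unfolding P_def Q_def by (intro graded_intros \<theta>_graded a)+
  obtain u where u: "e (Suc h) = t_var ^ Suc h * u"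
    using zs_order[OF a(2,3), of "Suc h"] by (auto simp: e_def dvd_def simp del: zrec.simps)
  obtain v where v: "e h = t_var ^ h * v"
    using zs_order[OF a(2,3), of h] by (auto simp: e_def dvd_def simp del: zrec.simps)
  obtain r where r: "w (Suc h) = t_var ^ Suc (2 * h) * r"
    using a(3) by (auto simp: w_def dvd_def simp del: zrec.simps)
  have u0: "coeff u 0 = lead_q (Suc h)"
    using zs_lead[OF a(2,3), of "Suc h"] u coeff_t_power_mult[of "Suc h" u "Suc h"]
    by (simp add: e_def del: zrec.simps power_Suc lead_q.simps)
  have v0: "coeff v 0 = lead_q h"
    using zs_lead[OF a(2,3), of h] v coeff_t_power_mult[of h v h]
    by (simp add: e_def del: zrec.simps power_Suc lead_q.simps)
  define t where "t = (\<theta> A + \<theta> C * (of_nat ((2 * h + 2) ^ 2) * (16 + t_var * x_var))) * r"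
  have "(t_var * (x_var * (16 + t_var * x_var))) ^ (2 * h) = \<theta> A * w (Suc h) + \<theta> B * e (Suc h) + \<theta> C * w (Suc (Suc h))"
    using arg_cong[OF D, of \<theta>] unfolding ring_hom_simps[OF \<theta>] ring_hom_power[OF \<theta>] \<theta>_D \<theta>_Z
    by (simp only: e_def w_def)
  also have "\<dots> = t_var ^ Suc (2 * h) * t + t_var ^ Suc h * (P * u + Q * v)"
    unfolding w_rec u v r P_def Q_def t_def by (simp add: algebra_simps)
  finally have "t_var ^ (2 * h) * (x_var * (16 + t_var * x_var)) ^ (2 * h) = t_var ^ Suc (2 * h) * t + t_var ^ Suc h * (P * u + Q * v)"
    unfolding power_mult_distrib[of t_var] .
  then have main: "t_var ^ Suc h * (P * u + Q * v) =
      t_var ^ (2 * h) * ((x_var * (16 + t_var * x_var)) ^ (2 * h) - t_var * t)"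
    unfolding right_diff_distrib power_Suc2[of t_var "2 * h"] mult.assoc by (simp only: add_diff_cancel_left')
  \<comment> \<open>This is the order left from t^(2h) after division by t^(h+1).\<close>
  define l where "l = h - 1"
  have hl: "h = Suc l" using h by (simp add: l_def)
  have "t_var ^ Suc h * (P * u + Q * v) = t_var ^ Suc h * (t_var ^ l * ((x_var * (16 + t_var * x_var)) ^ (2 * h) - t_var * t))"
  proof -
    have "2 * h = Suc h + l" using hl by simp
    then show ?thesis
      unfolding main by (simp only: power_add mult.assoc)
  qed
  moreover have "t_var ^ Suc h \<noteq> 0"
    by (simp add: t_var_def)
  ultimately have PuQv: "P * u + Q * v = t_var ^ l * ((x_var * (16 + t_var * x_var)) ^ (2 * h) - t_var * t)"
    using mult_cancel_left by blast
  \<comment> \<open>Below order \<open>l\<close> the right-hand side vanishes, so the lowest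
    coefficients of \<open>P\<close> and \<open>Q\<close> form a syzygy of
    \<open>lead_q (Suc h)\<close> and \<open>lead_q h\<close>. By gradedness their degrees are below
    \<open>h\<close>, which forces them to be zero.\<close>
  have low: "\<forall>k<i. coeff P k = 0 \<and> coeff Q k = 0" if "i \<le> l" for i
    using that
  proof (induction i)
    case (Suc i)
    have IH: "\<forall>k<i. coeff P k = 0" "\<forall>k<i. coeff Q k = 0"
      using Suc by auto
    have "coeff P i * lead_q (Suc h) + coeff Q i * lead_q h = coeff (P * u + Q * v) i"
      by (simp only: coeff_add coeff_mult_low[OF IH(1)] coeff_mult_low[OF IH(2)] u0 v0)
    also have "\<dots> = 0"
      unfolding PuQv coeff_t_power_mult using Suc.prems by simp
    finally have "coeff P i = 0 \<and> coeff Q i = 0"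
      by (rule no_low_syzygy[OF lead_q_facts])
        (use PQ(1) Suc.prems hl in \<open>auto simp: graded_def intro: le_less_trans\<close>)
    then show ?case using IH less_Suc_eq by auto
  qed simp
  have IH: "\<forall>k<l. coeff P k = 0" "\<forall>k<l. coeff Q k = 0"
    using low[of l] by auto
  \<comment> \<open>At order \<open>l\<close> the right-hand side is (16 x)^(2h), a combination
    excluded by \<open>monom_not_combination\<close>.\<close>
  have "coeff P l * lead_q (Suc h) + coeff Q l * lead_q h = coeff (P * u + Q * v) l"
    by (simp only: coeff_add coeff_mult_low[OF IH(1)] coeff_mult_low[OF IH(2)] u0 v0)
  also have "\<dots> = coeff ((x_var * (16 + t_var * x_var)) ^ (2 * h) - t_var * t) 0"
    unfolding PuQv coeff_t_power_mult by simp
  also have "\<dots> = smult (16 ^ (2 * h)) (monom 1 (2 * h))"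
    using smult_power[of "16 :: complex" "[:0, 1:]" "2 * h"]
    by (simp add: poly_0_coeff_0[symmetric] x_var_def t_var_def monom_altdef numeral_poly)
  finally have "smult (1 / 16 ^ (2 * h)) (coeff P l * lead_q (Suc h) + coeff Q l * lead_q h) = monom 1 (2 * h)"
    by (simp del: lead_q.simps)
  then have "smult (1 / 16 ^ (2 * h)) (coeff P l) * lead_q (Suc h) + smult (1 / 16 ^ (2 * h)) (coeff Q l) * lead_q h
      = monom 1 (2 * h)"
    by (simp only: smult_add_right mult_smult_left)
  moreover have "degree (smult (1 / 16 ^ (2 * h)) (coeff P l)) < h" "degree (smult (1 / 16 ^ (2 * h)) (coeff Q l)) < h"
    using PQ hl by (auto simp: graded_def less_Suc_eq_le)
  ultimately show False
    using monom_not_combination[OF lead_q_facts] by blast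
qed

subsection \<open>The exterior algebra and the main theorem\<close>

lemma u2_minus_64_iter: "(u2_minus_64 ^^ n) x k A = D ^ n * x k A"
  by (induction n arbitrary: k A)
    (simp_all add: u2_minus_64_def u_map_def algebra_simps power2_eq_square)

lemma gammaH_pow_support:
  "gammaH_pow g m C \<noteq> 0 \<Longrightarrow> C \<subseteq> {..<2 * g} \<and> card C = 2 * m"
proof (induction m arbitrary: C)
  case 0
  then show ?case by (simp add: gammaH_pow_def wunit_def split: if_splits)
next
  case (Suc m)
  have eq: "gammaH_pow g (Suc m) C = wedge (gammaH_pow g m) (gammaH g) C"
    by (simp add: gammaH_pow_def)
  then obtain A where A: "A \<subseteq> C" "gammaH_pow g m A \<noteq> (0 :: 'a)" "gammaH g (C - A) \<noteq> (0 :: 'a)"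
    using Suc.prems unfolding wedge_def by (metis (no_types, lifting) PowD mult_zero_left mult_zero_right sum.neutral)
  have 1: "A \<subseteq> {..<2 * g}" "card A = 2 * m"
    using Suc.IH[OF A(2)] by auto
  obtain i where i: "i < g" "C - A = {i, i + g}"
    using A(3) by (auto simp: gammaH_def split: if_splits)
  have "C = A \<union> (C - A)"
    using A(1) by auto
  moreover have "card (A \<union> (C - A)) = card A + card (C - A)"
    using 1(1) i by (intro card_Un_disjoint) (auto intro: finite_subset)
  moreover have "card (C - A) = 2" "C - A \<subseteq> {..<2 * g}"
    using i by auto
  ultimately show ?case
    using 1 by auto
qed

text \<open>The power \<open>g + 1\<close> of the 2-form has degree above the dimension
  \<open>2 * g\<close>, so it vanishes.\<close>

lemma wunit_mem_prim_elem: "prim_elem g 0 wunit"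
  unfolding prim_elem_def
proof (intro conjI allI impI)
  fix C
  have "gammaH_pow g (g - 0 + 1) B = (0 :: R)" for B
  proof (rule ccontr)
    assume "gammaH_pow g (g - 0 + 1) B \<noteq> (0 :: R)"
    then have "B \<subseteq> {..<2 * g}" "card B = 2 * (g + 1)"
      using gammaH_pow_support by force+
    then show False
      using card_mono[of "{..<2 * g}" B] by simp
  qed
  then have "wedge wunit (gammaH_pow g (g - 0 + 1)) C = (0 :: R)"
    by (simp add: wedge_def)
  then show "in_J (g - 0) (wedge wunit (gammaH_pow g (g - 0 + 1)) C)"
    using ring_ideal_zero[OF ring_ideal_J] by simp
qed (auto simp: wunit_def split: if_splits)

lemma zero_mem_prim_elem: "prim_elem g k (\<lambda>_. 0)"
  using ring_ideal_zero[OF ring_ideal_J[of "g - k"]] by (simp add: prim_elem_def wedge_def)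

lemma J_antimono: "g \<le> g' \<Longrightarrow> J g' \<subseteq> J g"
  by (induction rule: dec_induct) (use J_Suc_subset in blast)+

text \<open>One direction tests on the unit in exterior degree 0; for the other, every
  \<open>J (g - k)\<close> contains \<open>J g\<close>.\<close>

lemma op_vanishes_on_I_iff: "op_vanishes_on_I g n \<longleftrightarrow> D ^ n \<in> J g"
proof
  assume "op_vanishes_on_I g n"
  moreover define x :: "nat \<Rightarrow> nat set \<Rightarrow> R" where "x = (\<lambda>k. if k = 0 then wunit else (\<lambda>_. 0))"
  have "x \<in> Iprime g"
    by (auto simp: Iprime_def x_def wunit_mem_prim_elem zero_mem_prim_elem)
  ultimately have "Iprime_zero g ((u2_minus_64 ^^ n) x)"
    unfolding op_vanishes_on_I_def by blast
  then have "in_J (g - 0) ((u2_minus_64 ^^ n) x 0 {})"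
    unfolding Iprime_zero_def by blast
  then show "D ^ n \<in> J g"
    by (simp add: u2_minus_64_iter x_def wunit_def)
next
  assume D: "D ^ n \<in> J g"
  have "Iprime_zero g ((u2_minus_64 ^^ n) x)" for x
    unfolding Iprime_zero_def u2_minus_64_iter
  proof (intro allI impI)
    fix k A
    have "D ^ n \<in> J (g - k)"
      using D J_antimono[of "g - k" g] by auto
    then show "in_J (g - k) (D ^ n * x k A)"
      using J_mult[of "D ^ n" "g - k" "x k A"] by (simp add: mult.commute)
  qed
  then show "op_vanishes_on_I g n"
    by (simp add: op_vanishes_on_I_def)
qed

lemma D_power_mem_J_mono: "D ^ m \<in> J g \<Longrightarrow> m \<le> n \<Longrightarrow> D ^ n \<in> J g"
  using J_mult[of "D ^ m" g "D ^ (n - m)"] by (simp flip: power_add)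

text \<open>The inclusion of \<open>J (2 * h + 2)\<close> in \<open>J (2 * h + 1)\<close> carries
  the upper bound down from even genus and the lower bound up from odd genus; for
  \<open>h = 0\<close> the bound is just \<open>n \<ge> 1\<close>.\<close>

lemma D_power_mem_J_iff:
  assumes "n \<ge> 1"
  shows "D ^ n \<in> J (2 * h + 1) \<longleftrightarrow> 2 * h + 1 \<le> n" "D ^ n \<in> J (2 * h + 2) \<longleftrightarrow> 2 * h + 1 \<le> n"
proof -
  have up: "D ^ n \<in> J (2 * h + 2)" if "2 * h + 1 \<le> n"
    using D_power_mem_J_mono[OF D_power_mem_J_even[of "2 * h + 2"]] that by simp
  have low: "2 * h + 1 \<le> n" if "D ^ n \<in> J (2 * h + 1)"
  proof (cases "h = 0")
    case False
    then show ?thesis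
      using D_power_notin_J_odd[of h] D_power_mem_J_mono[OF that, of "2 * h"] by force
  qed (use assms in simp)
  have "J (2 * h + 2) \<subseteq> J (2 * h + 1)"
    by (rule J_antimono) simp
  then show "D ^ n \<in> J (2 * h + 1) \<longleftrightarrow> 2 * h + 1 \<le> n" "D ^ n \<in> J (2 * h + 2) \<longleftrightarrow> 2 * h + 1 \<le> n"
    using up low by blast+
qed

theorem theorem1p1:
  fixes g :: nat
  assumes "g \<ge> 1"
  shows "(\<exists>n\<ge>1. op_vanishes_on_I g n) \<and>
         (LEAST n. n \<ge> 1 \<and> op_vanishes_on_I g n) = 2 * nat \<lceil>real g / 2\<rceil> - 1"
proof -
  define h where "h = (g - 1) div 2"
  have g: "g = 2 * h + 1 \<or> g = 2 * h + 2"
    using assms unfolding h_def by presburger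
  then have vanish: "op_vanishes_on_I g n \<longleftrightarrow> 2 * h + 1 \<le> n" if "n \<ge> 1" for n
    unfolding op_vanishes_on_I_iff using D_power_mem_J_iff[OF that, of h] by blast
  have "\<lceil>real g / 2\<rceil> = int h + 1"
    using g by (intro ceiling_unique) auto
  then have "2 * nat \<lceil>real g / 2\<rceil> - 1 = 2 * h + 1"
    by simp
  moreover have "(LEAST n. n \<ge> 1 \<and> op_vanishes_on_I g n) = 2 * h + 1"
    by (rule Least_equality) (use vanish in auto)
  moreover have "\<exists>n\<ge>1. op_vanishes_on_I g n"
    using vanish[of "2 * h + 1"] by auto
  ultimately show ?thesis by simp
qed

end
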